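(* Let $\varepsilon,\delta\in(0,1)$ and let $(\mathbb{R}^d,\mathcal{R})$ be a range space with VC-dimension $\nu$. Suppose a labeled set $(X,y)$, with $x_i\in\mathbb{R}^d$ and $y_i\in\{-1,+1\}$, is presented as a general-expiration stream of $n$ labeled points. Then one can maintain an $(\varepsilon,\delta)$-PAC sketch for $(\mathbb{R}^d,\mathcal{R})$ that uses $\mathcal{O}((\nu/\varepsilon^2)d\log n\log(1/\delta))$ space and succeeds throughout the stream for all future times $t$.
   Context: General expiration stream: labeled items $(x_i,y_i)$ arrive in order, each with insertion time $S$ (non-decreasing) and arbitrary expiration time $E>S$; an item is active at time $t$ iff $S\le t<E$; for a future time $t$, $A(t)$ is the set of already inserted items active at $t$. For a range $R\in\mathcal{R}$ let $h_R(x)=+1$ if $x\in R$ and $-1$ otherwise. Let $h_t^*=h_{R^*}$ where $R^*$ minimizes $\Pr_{(x_i,y_i)}[h_R(x_i)\ne y_i]$ over $R\in\mathcal{R}$, with $(x_i,y_i)$ uniform over $A(t)$. An $(\varepsilon,\delta)$-PAC sketch, queried with a future time $t$, produces a prediction function $\hat h_t$ such that with probability at least $1-\delta$, $\bigl|\Pr[\hat h_t(x_i)\ne y_i]-\Pr[h_t^*(x_i)\ne y_i]\bigr|\le\varepsilon$, probabilities over $(x_i,y_i)$ uniform in $A(t)$, and this holds for all future times $t$. Space is measured in words. *)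

theory Defs
  imports "HOL-Probability.Probability" "HOL-Library.Extended_Nat"
begin

text \<open>
  The dimension \<open>d\<close> is quantified inside the statement, so that the constant hidden by the
  O-notation cannot depend on it.  Points of the \<open>d\<close>-dimensional space are therefore coordinate
  lists of length \<open>d\<close>.
\<close>

type_synonym point = "real list"

definition space_dim :: "nat \<Rightarrow> point set" where
  "space_dim d = {x. length x = d}"


subsection \<open>Range spaces\<close>

definition range_space :: "'a set \<Rightarrow> 'a set set \<Rightarrow> bool" where
  "range_space X \<R> \<longleftrightarrow> \<R> \<noteq> {} \<and> \<R> \<subseteq> Pow X"

definition shatters :: "'a set set \<Rightarrow> 'a set \<Rightarrow> bool" where
  "shatters \<R> A \<longleftrightarrow> (\<forall>B\<subseteq>A. \<exists>R\<in>\<R>. A \<inter> R = B)"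

definition VC_dim :: "'a set \<Rightarrow> 'a set set \<Rightarrow> enat" where
  "VC_dim X \<R> = Sup {enat (card A) | A. finite A \<and> A \<subseteq> X \<and> shatters \<R> A}"

definition range_fun :: "'a set \<Rightarrow> 'a \<Rightarrow> int" where
  "range_fun R x = (if x \<in> R then 1 else -1)"


subsection \<open>General expiration streams\<close>

datatype item = Item (pt: point) (label: int) (ins_time: real) (exp_time: real)

definition expiration_stream :: "nat \<Rightarrow> item list \<Rightarrow> bool" where
  "expiration_stream d xs \<longleftrightarrow>
     (\<forall>it\<in>set xs. pt it \<in> space_dim d \<and> label it \<in> {-1, 1} \<and> ins_time it < exp_time it) \<and>
     sorted (map ins_time xs)"

text \<open>
  Active items are represented by their positions in the stream, so that repeated items are
  counted with multiplicity.
\<close>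

definition active :: "item list \<Rightarrow> real \<Rightarrow> nat set" where
  "active xs t = {i. i < length xs \<and> ins_time (xs ! i) \<le> t \<and> t < exp_time (xs ! i)}"

definition err :: "item list \<Rightarrow> real \<Rightarrow> (point \<Rightarrow> int) \<Rightarrow> real" where
  "err xs t h =
     measure_pmf.prob (pmf_of_set (active xs t)) {i. h (pt (xs ! i)) \<noteq> label (xs ! i)}"

text \<open>
  A minimizer exists whenever \<open>active xs t\<close> and \<open>\<R>\<close> are nonempty, because the error then takes
  only finitely many values; all minimizers have the same error.
\<close>

definition best_fun :: "point set set \<Rightarrow> item list \<Rightarrow> real \<Rightarrow> point \<Rightarrow> int" where
  "best_fun \<R> xs t = range_fun (ARG_MIN (\<lambda>R. err xs t (range_fun R)) R. R \<in> \<R>)"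


subsection \<open>Randomized streaming sketches\<close>

text \<open>
  Everything that is retained between two stream items, including any random choices that are
  needed later, has to be written into the memory, whose size is its number of words.
\<close>

type_synonym memory = "real list"

datatype sketch = Sketch
  (start: "memory pmf")
  (update: "item \<Rightarrow> memory \<Rightarrow> memory pmf")
  (query: "memory \<Rightarrow> real \<Rightarrow> point \<Rightarrow> int")

definition run :: "sketch \<Rightarrow> item list \<Rightarrow> memory pmf" where
  "run sk xs = fold (\<lambda>it p. bind_pmf p (update sk it)) xs (start sk)"

text \<open>
  A word is a coordinate or a time copied from the part of the stream read so far, or an integer
  with \<open>O(log n)\<close> bits.  Without such a restriction a single real word could encode the whole
  stream, and every space bound would be trivial.
\<close>

definition words :: "nat \<Rightarrow> nat \<Rightarrow> item list \<Rightarrow> real set" where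
  "words c n xs =
     (\<Union>it\<in>set xs. set (pt it) \<union> {ins_time it, exp_time it}) \<union>
     {of_int z | z. \<bar>z\<bar> \<le> int (n ^ c)}"

definition uses_space :: "nat \<Rightarrow> nat \<Rightarrow> nat \<Rightarrow> sketch \<Rightarrow> real \<Rightarrow> bool" where
  "uses_space c d n sk B \<longleftrightarrow>
     (\<forall>xs. expiration_stream d xs \<longrightarrow> length xs = n \<longrightarrow>
       (\<forall>m\<le>n. \<forall>s\<in>set_pmf (run sk (take m xs)).
          set s \<subseteq> words c n (take m xs) \<and> real (length s) \<le> B))"

text \<open>
  After \<open>m\<close> insertions the future times are those not before the last insertion.  The error
  probabilities are meaningful only if some inserted item is active at time \<open>t\<close>.
\<close>

definition PAC_sketch ::
    "nat \<Rightarrow> point set set \<Rightarrow> nat \<Rightarrow> real \<Rightarrow> real \<Rightarrow> sketch \<Rightarrow> bool" where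
  "PAC_sketch d \<R> n \<epsilon> \<delta> sk \<longleftrightarrow>
     (\<forall>s t x. query sk s t x \<in> {-1, 1}) \<and>
     (\<forall>xs. expiration_stream d xs \<longrightarrow> length xs = n \<longrightarrow>
       (\<forall>m\<le>n. \<forall>t.
          (\<forall>it\<in>set (take m xs). ins_time it \<le> t) \<longrightarrow> active (take m xs) t \<noteq> {} \<longrightarrow>
          measure_pmf.prob (run sk (take m xs))
            {s. \<bar>err (take m xs) t (query sk s t)
                 - err (take m xs) t (best_fun \<R> (take m xs) t)\<bar> \<le> \<epsilon>} \<ge> 1 - \<delta>))"

text \<open>
  The usual convention for logarithmic factors inside the O-notation: they are at least 1.  For
  arguments \<open>\<ge> 2\<close> this is just the binary logarithm.
\<close>

definition lg :: "real \<Rightarrow> real" where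
  "lg x = max 1 (log 2 x)"

end

theory Submission
  imports Defs
begin

text \<open>
  The sketch runs about \<open>log (1/\<delta>)\<close> independent copies of a sampler with about \<open>log n\<close> levels.  Level \<open>j\<close>
  of a copy sees every item with probability \<open>2 ^ -j\<close> and keeps the \<open>K = O(\<nu>/\<epsilon>\<^sup>2)\<close> seen items that
  expire last.  If fewer than \<open>K\<close> kept items are active at time \<open>t\<close>, then no seen item that is active
  at \<open>t\<close> was dropped, so the lowest such level is an honest sample of the active items.

  Level \<open>j + 1\<close> is a random half of level \<open>j\<close>.  The deviation between the two is a Rademacher sum,
  and chaining bounds its expected supremum over a class of VC dimension \<open>\<nu>\<close> on \<open>s\<close> points by
  \<open>O(sqrt (\<nu> s))\<close>, without the factor \<open>log (1/\<epsilon>)\<close> that a union bound over all dichotomies costs.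
  The sum over the levels is geometric, so with probability \<open>15/16\<close> one copy estimates the error
  counts of all ranges simultaneously at whichever low level is used.  The median over the copies
  boosts this to \<open>1 - \<delta>\<close>, and the answer is a range that minimizes the median.
\<close>

section \<open>Shattering and packing\<close>

text \<open>The active set depends on \<open>t\<close>, which is unknown while the coins are tossed.
  Since \<open>PAC_sketch\<close> bounds the failure probability for each prefix and each time
  separately, one active set of some size \<open>N\<close> can be fixed before the coins are
  considered, and no union over times is taken. The level that a query reads still depends on the
  coins, so the deviation is controlled at all levels up to a threshold that depends only on
  \<open>N\<close>, \<open>K\<close> and \<open>J\<close>. This costs only a constant factor: the
  deviations telescope into signed sums, the bound for term \<open>i\<close> is of order
  \<open>sqrt (\<nu> * N * 2 ^ i)\<close>, and the last one dominates. Halving yields independent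
  signs directly, so no symmetrization with a ghost sample is required. The class that is chained
  consists of the error sets of the ranges, taken as sets of stream positions; a label merely flips
  membership, so the dimension does not grow. For \<open>\<nu> = 0\<close> the claimed space is
  zero, which forces a separate sketch with empty memory.\<close>

lemma shatters_mono: "F \<subseteq> G \<Longrightarrow> shatters F A \<Longrightarrow> shatters G A"
  unfolding shatters_def by (meson subsetD)

text \<open>Pajor's inequality. Splitting \<open>F\<close> by membership of \<open>x\<close> gives
  two families on \<open>X\<close>; a set shattered by both stays shattered by \<open>F\<close> when
  \<open>x\<close> is added to it.\<close>

lemma card_le_card_shattered:
  assumes "finite X" "F \<subseteq> Pow X"
  shows "card F \<le> card {A. A \<subseteq> X \<and> shatters F A}"
  using assms
proof (induction X arbitrary: F rule: finite_induct)
  case empty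
  show ?case
  proof (cases "F = {}")
    case False
    with empty have "F = {{}}" by auto
    then have "{A. A \<subseteq> {} \<and> shatters F A} = {{}}" by (auto simp: shatters_def)
    with \<open>F = {{}}\<close> show ?thesis by simp
  qed auto
next
  case (insert x X)
  define F0 where "F0 = {A \<in> F. x \<notin> A}"
  define F1 where "F1 = (\<lambda>A. A - {x}) ` {A \<in> F. x \<in> A}"
  define S0 where "S0 = {A. A \<subseteq> X \<and> shatters F0 A}"
  define S1 where "S1 = {A. A \<subseteq> X \<and> shatters F1 A}"
  have finF: "finite F" using insert.prems insert.hyps by (meson finite.insertI finite_Pow_iff finite_subset)
  have "F = F0 \<union> {A \<in> F. x \<in> A}" by (auto simp: F0_def)
  then have "card F = card F0 + card {A \<in> F. x \<in> A}"
    using finF by (subst card_Un_disjoint[symmetric]) (auto simp: F0_def)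
  also have "card {A \<in> F. x \<in> A} = card F1"
    unfolding F1_def by (subst card_image) (auto simp: inj_on_def)
  finally have c: "card F = card F0 + card F1" .
  have "F0 \<subseteq> Pow X" "F1 \<subseteq> Pow X" using insert.prems by (auto simp: F0_def F1_def)
  then have IH: "card F0 \<le> card S0" "card F1 \<le> card S1"
    using insert.IH by (auto simp: S0_def S1_def)
  have fin: "finite S0" "finite S1" using insert.hyps by (auto simp: S0_def S1_def)
  have sub1: "shatters F A" if A: "A \<in> S0 \<union> S1" for A
    unfolding shatters_def
  proof (intro allI impI)
    fix B assume B: "B \<subseteq> A"
    have xA: "x \<notin> A" using A insert.hyps by (auto simp: S0_def S1_def)
    have "shatters F0 A \<or> shatters F1 A" using A by (auto simp: S0_def S1_def)
    with B obtain R where R: "R \<in> F0 \<union> F1" "A \<inter> R = B" unfolding shatters_def by blast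
    show "\<exists>R\<in>F. A \<inter> R = B"
    proof (cases "R \<in> F0")
      case True then show ?thesis using R by (auto simp: F0_def)
    next
      case False
      then obtain R' where "R' \<in> F" "R = R' - {x}" using R by (auto simp: F1_def)
      then show ?thesis using R xA by (intro bexI[of _ R']) auto
    qed
  qed
  have sub2: "shatters F (insert x A)" if A: "A \<in> S0 \<inter> S1" for A
    unfolding shatters_def
  proof (intro allI impI)
    fix B assume B: "B \<subseteq> insert x A"
    have xA: "x \<notin> A" using A insert.hyps by (auto simp: S0_def)
    have B': "B - {x} \<subseteq> A" using B by auto
    show "\<exists>R\<in>F. insert x A \<inter> R = B"
    proof (cases "x \<in> B")
      case True
      obtain R where R: "R \<in> F1" "A \<inter> R = B - {x}" using A B' unfolding S1_def shatters_def by blast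
      then obtain R' where R': "R' \<in> F" "x \<in> R'" "R = R' - {x}" by (auto simp: F1_def)
      have "insert x A \<inter> R' = B" using R R' xA True by auto
      then show ?thesis using R' by auto
    next
      case False
      obtain R where R: "R \<in> F0" "A \<inter> R = B - {x}" using A B' unfolding S0_def shatters_def by blast
      have "insert x A \<inter> R = B" using R False xA by (auto simp: F0_def)
      then show ?thesis using R by (auto simp: F0_def)
    qed
  qed
  \<comment> \<open>Sets in both \<open>S0\<close> and \<open>S1\<close> are counted twice; their
    second copies are paid for by the shattered sets that contain \<open>x\<close>.\<close>
  have "card S0 + card S1 = card (S0 \<union> S1) + card (S0 \<inter> S1)"
    using fin by (rule card_Un_Int)
  also have "card (S0 \<inter> S1) = card (insert x ` (S0 \<inter> S1))"
    by (subst card_image) (use insert.hyps in \<open>auto simp: inj_on_def S0_def\<close>)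
  also have "card (S0 \<union> S1) + \<dots> = card ((S0 \<union> S1) \<union> insert x ` (S0 \<inter> S1))"
    by (subst card_Un_disjoint) (use insert.hyps fin in \<open>auto simp: S0_def S1_def\<close>)
  also have "\<dots> \<le> card {A. A \<subseteq> insert x X \<and> shatters F A}"
  proof (rule card_mono)
    show "finite {A. A \<subseteq> insert x X \<and> shatters F A}" using insert.hyps by auto
    show "(S0 \<union> S1) \<union> insert x ` (S0 \<inter> S1) \<subseteq> {A. A \<subseteq> insert x X \<and> shatters F A}"
      using sub1 sub2 by (auto simp: S0_def S1_def)
  qed
  finally show ?case using c IH by linarith
qed

text \<open>
  Weighting a subset \<open>A\<close> by \<open>x ^ card A\<close> gives a form of the Sauer--Shelah bound in which \<open>x\<close> can
  still be optimized.
\<close>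

lemma Sauer_Shelah_weighted:
  fixes x :: real
  assumes X: "finite X" "F \<subseteq> Pow X" and VC: "\<And>A. finite A \<Longrightarrow> shatters F A \<Longrightarrow> card A \<le> \<nu>"
    and x: "0 < x" "x \<le> 1"
  shows "real (card F) * x ^ \<nu> \<le> (1 + x) ^ card X"
proof -
  let ?S = "{A. A \<subseteq> X \<and> shatters F A}"
  have fin: "finite ?S" using X by auto
  have "real (card F) * x ^ \<nu> \<le> real (card ?S) * x ^ \<nu>"
    using card_le_card_shattered[OF X] x by (intro mult_right_mono) auto
  also have "\<dots> = (\<Sum>A\<in>?S. x ^ \<nu>)" by simp
  also have "\<dots> \<le> (\<Sum>A\<in>?S. x ^ card A)"
    using VC X x by (intro sum_mono power_decreasing) (auto intro: finite_subset)
  also have "\<dots> \<le> (\<Sum>A\<in>Pow X. x ^ card A)"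
    using X x by (intro sum_mono2) auto
  also have "\<dots> = (\<Prod>i\<in>X. x + 1)"
    using X by (subst prod_add) auto
  finally show ?thesis by (simp add: add.commute)
qed

lemma ln4_le: "ln 4 \<le> (7/5 :: real)"
proof -
  have "ln (4::real) = 2 * ln 2" using ln_realpow[of 2 2] by simp
  then show ?thesis using ln2_le_25_over_36 by simp
qed

text \<open>
  Some tuple of about \<open>2 ln (card G) / \<alpha>\<close> points separates all members of \<open>G\<close>, so the Sauer--Shelah bound
  on that tuple, with \<open>x = \<alpha> / 4\<close>, limits \<open>card G\<close>.
\<close>

lemma packing_bound:
  fixes \<alpha> :: real
  assumes S: "finite S" "G \<subseteq> Pow S" and VC: "\<And>A. finite A \<Longrightarrow> shatters G A \<Longrightarrow> card A \<le> \<nu>"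
    and \<alpha>: "0 < \<alpha>" "\<alpha> \<le> 1"
    and sep: "\<And>D E. D \<in> G \<Longrightarrow> E \<in> G \<Longrightarrow> D \<noteq> E \<Longrightarrow> real (card (sym_diff D E)) > \<alpha> * real (card S)"
    and ne: "G \<noteq> {}"
  shows "ln (real (card G)) \<le> 1/2 + 2 * real \<nu> * ln (4 / \<alpha>)"
proof -
  have ln\<alpha>: "ln (4 / \<alpha>) \<ge> 0" using \<alpha> by (intro ln_ge_zero) (simp add: field_simps)
  have finG: "finite G" using S by (meson finite_Pow_iff finite_subset)
  define M where "M = card G"
  have M0: "M > 0" using finG ne by (simp add: M_def card_gt_0_iff)
  \<comment> \<open>A random point misses a given symmetric difference with probability below
    \<open>exp (- \<alpha>)\<close>, so this many points all miss it with probability at most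
    \<open>1 / M ^ 2\<close>.\<close>
  define m where "m = nat \<lceil>2 * ln (real M) / \<alpha>\<rceil>"
  have lnM: "ln (real M) \<ge> 0" using M0 by simp
  have m1: "real m \<ge> 2 * ln (real M) / \<alpha>" unfolding m_def by linarith
  have m2: "real m \<le> 2 * ln (real M) / \<alpha> + 1" unfolding m_def using lnM \<alpha> by (simp add: of_nat_nat)
  show ?thesis
  proof (cases "S = {}")
    case True
    then have "G \<subseteq> {{}}" using S by auto
    then have "M \<le> 1" unfolding M_def using card_mono[of "{{}}" G] by simp
    with M0 have "M = 1" by simp
    then show ?thesis using ln\<alpha> by (simp add: M_def)
  next
    case False
    define s where "s = card S"
    have s0: "s > 0" using S False by (simp add: s_def card_gt_0_iff)
    define T where "T = {..<m} \<rightarrow>\<^sub>E S"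
    define P where "P = {(D, E). D \<in> G \<and> E \<in> G \<and> D \<noteq> E}"
    have Peq: "P = G \<times> G - (\<lambda>D. (D, D)) ` G" by (auto simp: P_def)
    have cP: "real (card P) = real M * real M - real M"
    proof -
      have "card P = M * M - M" unfolding Peq
        by (subst card_Diff_subset) (use finG in \<open>auto simp: M_def card_image inj_on_def card_cartesian_product\<close>)
      then show ?thesis using M0 by (simp add: of_nat_diff)
    qed
    have finP: "finite P" using finG unfolding Peq by auto
    \<comment> \<open>Probabilistic method by counting: each of the \<open>M * M - M\<close> ordered
      pairs rules out at most \<open>s ^ m / (M * M)\<close> tuples, together fewer than all
      \<open>s ^ m\<close>.\<close>
    have "\<exists>f\<in>T. \<forall>(D, E)\<in>P. f ` {..<m} \<inter> sym_diff D E \<noteq> {}"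
    proof (rule ccontr)
      assume "\<not> ?thesis"
      then have no: "\<exists>(D, E)\<in>P. f ` {..<m} \<inter> sym_diff D E = {}" if "f \<in> T" for f
        using that unfolding case_prod_unfold by blast
      have sub: "T \<subseteq> (\<Union>(D, E)\<in>P. {..<m} \<rightarrow>\<^sub>E (S - sym_diff D E))"
      proof
        fix f assume f: "f \<in> T"
        then obtain D E where DE: "(D, E) \<in> P" "f ` {..<m} \<inter> sym_diff D E = {}" using no[OF f] by blast
        have "f i \<in> S - sym_diff D E" if "i < m" for i
          using f DE(2) that unfolding T_def by (metis DiffI IntI PiE_mem empty_iff imageI lessThan_iff)
        moreover have "f \<in> extensional {..<m}" using f by (simp add: T_def PiE_def)
        ultimately have "f \<in> {..<m} \<rightarrow>\<^sub>E (S - sym_diff D E)" by (intro PiE_I) (auto simp: extensional_def)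
        with DE(1) show "f \<in> (\<Union>(D, E)\<in>P. {..<m} \<rightarrow>\<^sub>E (S - sym_diff D E))" by (intro UN_I[of "(D, E)"]) auto
      qed
      have finU: "finite (\<Union>(D, E)\<in>P. {..<m} \<rightarrow>\<^sub>E (S - sym_diff D E))"
        using finP S by (auto intro!: finite_PiE)
      have one: "real (card ({..<m} \<rightarrow>\<^sub>E (S - sym_diff D E))) \<le> (real s ^ m) / (real M * real M)" if "(D, E) \<in> P" for D E
      proof -
        have DE: "sym_diff D E \<subseteq> S" using that S by (auto simp: P_def)
        have "real (card (S - sym_diff D E)) = real s - real (card (sym_diff D E))"
          using card_Diff_subset[OF finite_subset[OF DE S(1)] DE] card_mono[OF S(1) DE]
          by (simp add: s_def of_nat_diff)
        also have "\<dots> \<le> (1 - \<alpha>) * real s"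
          using sep[of D E] that by (simp add: P_def s_def algebra_simps)
        also have "\<dots> \<le> exp (- \<alpha>) * real s"
          using exp_ge_add_one_self[of "-\<alpha>"] by (intro mult_right_mono) simp_all
        finally have "real (card (S - sym_diff D E)) ^ m \<le> (exp (- \<alpha>) * real s) ^ m"
          by (intro power_mono) auto
        moreover have "(exp (- \<alpha>) * real s) ^ m = exp (- (\<alpha> * real m)) * real s ^ m"
          by (simp add: power_mult_distrib flip: exp_of_nat2_mult)
        moreover have "exp (- (\<alpha> * real m)) * real s ^ m \<le> (1 / (real M * real M)) * real s ^ m"
        proof (rule mult_right_mono)
          have "2 * ln (real M) \<le> \<alpha> * real m"
            using m1 \<alpha> pos_divide_le_eq[of \<alpha> "2 * ln (real M)" "real m"] by (metis mult.commute)
          then have "exp (- (\<alpha> * real m)) \<le> exp (- (2 * ln (real M)))"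
            by (simp only: exp_le_cancel_iff neg_le_iff_le)
          also have "exp (- (2 * ln (real M))) = 1 / (real M * real M)"
            using M0 by (simp add: exp_minus exp_double power2_eq_square divide_inverse)
          finally show "exp (- (\<alpha> * real m)) \<le> 1 / (real M * real M)" .
        qed simp
        ultimately have "real (card (S - sym_diff D E)) ^ m \<le> real s ^ m / (real M * real M)" by simp
        then show ?thesis by (simp add: card_PiE)
      qed
      define q where "q = real s ^ m / (real M * real M)"
      define W where "W = (\<lambda>p. {..<m} \<rightarrow>\<^sub>E (S - sym_diff (fst p) (snd p)))"
      have "real s ^ m = real (card T)" by (simp add: T_def card_PiE s_def)
      also have "card T \<le> card (\<Union>p\<in>P. W p)"
        using card_mono[OF finU sub] by (simp add: case_prod_unfold W_def)
      also have "card (\<Union>p\<in>P. W p) \<le> (\<Sum>p\<in>P. card (W p))"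
        by (rule card_UN_le[OF finP])
      also have "real (\<Sum>p\<in>P. card (W p)) \<le> (\<Sum>p\<in>P. q)"
        unfolding of_nat_sum using one by (intro sum_mono) (auto simp: W_def q_def)
      finally have "real s ^ m \<le> (real M * real M - real M) * q" by (simp add: cP)
      moreover have "real M * real M * q = real s ^ m" "real M * q > 0"
        using M0 s0 by (simp_all add: q_def)
      ultimately show False by (simp add: left_diff_distrib)
    qed
    then obtain f where f: "f \<in> T" "\<forall>(D, E)\<in>P. f ` {..<m} \<inter> sym_diff D E \<noteq> {}" by (elim bexE)
    define X where "X = f ` {..<m}"
    define H where "H = (\<lambda>E. E \<inter> X) ` G"
    have "inj_on (\<lambda>E. E \<inter> X) G"
    proof (rule inj_onI, rule ccontr)
      fix D E assume DE: "D \<in> G" "E \<in> G" "D \<inter> X = E \<inter> X" "D \<noteq> E"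
      then have "(D, E) \<in> P" by (simp add: P_def)
      from bspec[OF f(2) this] have "X \<inter> sym_diff D E \<noteq> {}" by (simp only: X_def prod.case not_False_eq_True)
      with DE(3) show False by blast
    qed
    then have cH: "card H = M" by (simp add: H_def card_image M_def)
    have VCH: "card A \<le> \<nu>" if "finite A" "shatters H A" for A
    proof -
      have "A \<subseteq> X"
      proof -
        from that(2) obtain R where "R \<in> H" "A \<inter> R = A" unfolding shatters_def by blast
        then show ?thesis by (auto simp: H_def)
      qed
      then have "A \<inter> (E \<inter> X) = A \<inter> E" for E by blast
      then have "shatters G A" using that(2) by (simp add: shatters_def H_def)
      then show ?thesis using VC that by auto
    qed
    \<comment> \<open>With this \<open>x\<close>, the exponent \<open>m * x\<close> is at most
      \<open>ln M / 2 + 1 / 4\<close>. Half of \<open>ln M\<close> thus moves to the other side,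
      which doubles the remaining terms.\<close>
    define x where "x = \<alpha> / 4"
    have x: "0 < x" "x \<le> 1" using \<alpha> by (auto simp: x_def)
    have "real M * x ^ \<nu> \<le> (1 + x) ^ card X"
      using Sauer_Shelah_weighted[of X H \<nu> x] VCH x cH by (auto simp: X_def H_def)
    also have "\<dots> \<le> (1 + x) ^ m"
      using x card_image_le[of "{..<m}" f] by (intro power_increasing) (auto simp: X_def)
    also have "\<dots> \<le> exp (x) ^ m"
      using x by (intro power_mono) auto
    also have "\<dots> = exp (real m * x)" by (simp add: exp_of_nat_mult)
    finally have "ln (real M * x ^ \<nu>) \<le> ln (exp (real m * x))"
      using M0 x by (subst ln_le_cancel_iff) auto
    then have "ln (real M * x ^ \<nu>) \<le> real m * x" by simp
    then have "ln (real M) + real \<nu> * ln x \<le> real m * x"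
      using M0 x by (simp add: ln_mult ln_realpow)
    moreover have "real m * x \<le> ln (real M) / 2 + 1 / 4"
    proof -
      have "real m * x \<le> (2 * ln (real M) / \<alpha> + 1) * x" using m2 x by (intro mult_right_mono) auto
      also have "\<dots> = ln (real M) / 2 + \<alpha> / 4" using \<alpha> by (simp add: x_def field_simps)
      finally show ?thesis using \<alpha> by linarith
    qed
    moreover have "ln x = - ln (4 / \<alpha>)" using \<alpha> by (simp add: x_def ln_div)
    ultimately show ?thesis by (simp add: M_def)
  qed
qed

text \<open>The power series are compared term by term, by
  \<open>2 ^ n * fact n <= fact (2 * n)\<close>. This is the sub-Gaussian bound for a single
  sign.\<close>

lemma cosh_le_exp_square: "cosh x \<le> exp (x\<^sup>2 / 2)" for x :: real
proof -
  have "(\<lambda>n. (x\<^sup>2 / 2) ^ n /\<^sub>R fact n) sums exp (x\<^sup>2 / 2)" by (rule exp_converges)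
  moreover have "(\<lambda>n. x ^ (2 * n) /\<^sub>R fact (2 * n)) sums cosh x"
  proof -
    have "strict_mono (\<lambda>n::nat. 2 * n)" by (auto simp: strict_mono_def)
    moreover have "(if even n then x ^ n /\<^sub>R fact n else 0) = 0" if "n \<notin> range (\<lambda>n. 2 * n)" for n :: nat
      using that by (auto elim!: evenE)
    ultimately have "(\<lambda>n. if even (2 * n) then x ^ (2 * n) /\<^sub>R fact (2 * n) else 0) sums cosh x"
      using cosh_converges[of x] by (subst sums_mono_reindex)
    then show ?thesis by simp
  qed
  moreover have "x ^ (2 * n) /\<^sub>R fact (2 * n) \<le> (x\<^sup>2 / 2) ^ n /\<^sub>R fact n" for n
  proof -
    have "(2::real) ^ n * fact n \<le> fact (2 * n)"
    proof (induction n)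
      case (Suc n)
      have "(2::real) ^ Suc n * fact (Suc n) = (2 * real (Suc n)) * (2 ^ n * fact n)" by simp
      also have "\<dots> \<le> (2 * real (Suc n)) * fact (2 * n)" by (rule mult_left_mono[OF Suc]) auto
      also have "\<dots> \<le> (2 * real (Suc n)) * (real (2 * n + 1) * fact (2 * n))"
        by (intro mult_left_mono) auto
      also have "\<dots> = fact (2 * Suc n)" by (simp add: algebra_simps)
      finally show ?case .
    qed auto
    then have "(x\<^sup>2) ^ n / fact (2 * n) \<le> (x\<^sup>2) ^ n / (2 ^ n * fact n)"
      by (intro divide_left_mono) auto
    moreover have "x ^ (2 * n) /\<^sub>R fact (2 * n) = (x\<^sup>2) ^ n / fact (2 * n)"
      by (simp only: power_mult[of x 2 n] real_scaleR_def divide_inverse) (rule mult.commute)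
    moreover have "(x\<^sup>2 / 2) ^ n /\<^sub>R fact n = (x\<^sup>2) ^ n / (2 ^ n * fact n)"
      by (subst power_divide) (simp only: real_scaleR_def divide_inverse inverse_mult_distrib mult_ac)
    ultimately show ?thesis by simp
  qed
  ultimately show ?thesis by (meson sums_le)
qed

section \<open>Rademacher sums over a VC class\<close>

text \<open>A uniform subset \<open>B\<close> encodes independent uniform signs. Members of
  \<open>B\<close> get the minus sign so that the sum over \<open>E\<close> is
  \<open>card E - 2 * card (E \<inter> B)\<close>, the error made by doubling the half that is
  kept.\<close>

definition sgn_of :: "'a set \<Rightarrow> 'a \<Rightarrow> real" where
  "sgn_of B i = (if i \<in> B then -1 else 1)"

text \<open>Summing over all sign patterns factorizes into one factor
  \<open>2 * cosh (l * w i)\<close> per element.\<close>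

lemma rademacher_mgf:
  fixes w :: "'a \<Rightarrow> real"
  assumes U: "finite U" and v: "(\<Sum>i\<in>U. (w i)\<^sup>2) \<le> v"
  shows "(\<Sum>B\<in>Pow U. exp (l * (\<Sum>i\<in>U. w i * sgn_of B i))) \<le> 2 ^ card U * exp (l\<^sup>2 * v / 2)"
proof -
  have "(\<Sum>B\<in>Pow U. exp (l * (\<Sum>i\<in>U. w i * sgn_of B i))) =
    (\<Sum>B\<in>Pow U. (\<Prod>i\<in>B. exp (- (l * w i))) * (\<Prod>i\<in>U - B. exp (l * w i)))"
  proof (rule sum.cong[OF refl])
    fix B assume "B \<in> Pow U"
    then have B: "B \<subseteq> U" by auto
    have "(\<Sum>i\<in>U. l * (w i * sgn_of B i)) = (\<Sum>i\<in>U - B. l * (w i * sgn_of B i)) + (\<Sum>i\<in>B. l * (w i * sgn_of B i))"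
      using B U by (rule sum.subset_diff)
    also have "(\<Sum>i\<in>U - B. l * (w i * sgn_of B i)) = (\<Sum>i\<in>U - B. l * w i)"
      by (intro sum.cong) (auto simp: sgn_of_def)
    also have "(\<Sum>i\<in>B. l * (w i * sgn_of B i)) = (\<Sum>i\<in>B. - (l * w i))"
      by (intro sum.cong) (auto simp: sgn_of_def)
    finally show "exp (l * (\<Sum>i\<in>U. w i * sgn_of B i)) = (\<Prod>i\<in>B. exp (- (l * w i))) * (\<Prod>i\<in>U - B. exp (l * w i))"
      using B U by (simp add: sum_distrib_left exp_add exp_sum finite_subset)
  qed
  also have "\<dots> = (\<Prod>i\<in>U. exp (- (l * w i)) + exp (l * w i))"
    using U by (rule prod_add[symmetric])
  also have "\<dots> \<le> (\<Prod>i\<in>U. 2 * exp ((l * w i)\<^sup>2 / 2))"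
  proof (intro prod_mono conjI)
    fix i
    show "exp (- (l * w i)) + exp (l * w i) \<le> 2 * exp ((l * w i)\<^sup>2 / 2)"
      using cosh_le_exp_square[of "l * w i"] by (simp add: cosh_field_def)
  qed (simp add: add_nonneg_nonneg)
  also have "\<dots> = 2 ^ card U * exp (\<Sum>i\<in>U. (l * w i)\<^sup>2 / 2)"
    using U by (simp add: prod.distrib exp_sum)
  also have "(\<Sum>i\<in>U. (l * w i)\<^sup>2 / 2) = l\<^sup>2 * (\<Sum>i\<in>U. (w i)\<^sup>2) / 2"
    by (simp add: power_mult_distrib sum_distrib_left sum_divide_distrib)
  also have "2 ^ card U * exp (l\<^sup>2 * (\<Sum>i\<in>U. (w i)\<^sup>2) / 2) \<le> 2 ^ card U * exp (l\<^sup>2 * v / 2)"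
    using v by (intro mult_left_mono) (auto intro!: mult_left_mono)
  finally show ?thesis .
qed

text \<open>
  The maximum is dominated by means of \<open>x \<le> a + exp (l * (x - a)) / l\<close>, which replaces it by a sum
  of moment generating functions.
\<close>

lemma rademacher_maximal:
  fixes w :: "'l \<Rightarrow> 'a \<Rightarrow> real"
  assumes U: "finite U" and L: "finite L" and v: "v > 0" "\<And>x. x \<in> L \<Longrightarrow> (\<Sum>i\<in>U. (w x i)\<^sup>2) \<le> v"
    and h: "h \<ge> 1/2" "2 * real (card L) \<le> exp h"
  shows "\<exists>Y. (\<forall>B. \<forall>x\<in>L. \<bar>\<Sum>i\<in>U. w x i * sgn_of B i\<bar> \<le> Y B) \<and> (\<forall>B. 0 \<le> Y B) \<and>
    (\<Sum>B\<in>Pow U. Y B) \<le> 2 ^ card U * (2 * sqrt (2 * v * h))"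
proof -
  \<comment> \<open>The choice gives \<open>l * a = 2 * h\<close> and
    \<open>l\<^sup>2 * v / 2 = h\<close>. The factor \<open>exp (- (2 * h))\<close> then cancels
    \<open>exp h\<close> from the size of \<open>L\<close> and \<open>exp h\<close> from the moment
    generating function.\<close>
  define a where "a = sqrt (2 * v * h)"
  define l where "l = a / v"
  define X where "X = (\<lambda>x B. \<Sum>i\<in>U. w x i * sgn_of B i)"
  have a0: "a > 0" using v h by (simp add: a_def)
  have a2: "a\<^sup>2 = 2 * v * h" using v h by (simp add: a_def)
  have l0: "l > 0" using a0 v by (simp add: l_def)
  have la: "l * a = 2 * h" using a2 v by (simp add: l_def power2_eq_square)
  have l2: "l\<^sup>2 * v = 2 * h" using a2 v by (simp add: l_def power2_eq_square)
  define Y where "Y = (\<lambda>B. a + (\<Sum>x\<in>L. exp (l * X x B) + exp (l * - X x B)) * exp (- (2 * h)) / l)"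
  have pos: "0 \<le> (\<Sum>x\<in>L. exp (l * X x B) + exp (l * - X x B)) * exp (- (2 * h)) / l" for B
    using l0 by (intro divide_nonneg_pos mult_nonneg_nonneg sum_nonneg) (auto intro: add_nonneg_nonneg)
  show ?thesis
  proof (intro exI[of _ Y] conjI allI ballI)
    show "0 \<le> Y B" for B using pos[of B] a0 by (simp add: Y_def)
    show "\<bar>\<Sum>i\<in>U. w x i * sgn_of B i\<bar> \<le> Y B" if x: "x \<in> L" for B x
    proof -
      have "l * (\<bar>X x B\<bar> - a) \<le> exp (l * (\<bar>X x B\<bar> - a))"
        using exp_ge_add_one_self[of "l * (\<bar>X x B\<bar> - a)"] by linarith
      also have "\<dots> = exp (l * \<bar>X x B\<bar>) * exp (- (2 * h))"
        using la by (simp add: right_diff_distrib exp_diff exp_minus divide_inverse)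
      also have "\<dots> \<le> (exp (l * X x B) + exp (l * - X x B)) * exp (- (2 * h))"
        by (intro mult_right_mono) (auto simp: abs_if)
      also have "\<dots> \<le> (\<Sum>x\<in>L. exp (l * X x B) + exp (l * - X x B)) * exp (- (2 * h))"
        using L x by (intro mult_right_mono member_le_sum) (auto intro: add_nonneg_nonneg)
      finally have "\<bar>X x B\<bar> - a \<le> (\<Sum>x\<in>L. exp (l * X x B) + exp (l * - X x B)) * exp (- (2 * h)) / l"
        using l0 by (simp only: pos_le_divide_eq mult.commute)
      then show ?thesis by (simp add: Y_def X_def)
    qed
    have one: "(\<Sum>B\<in>Pow U. exp (l * X x B)) \<le> 2 ^ card U * exp h"
              "(\<Sum>B\<in>Pow U. exp (l * - X x B)) \<le> 2 ^ card U * exp h" if "x \<in> L" for x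
      using rademacher_mgf[OF U v(2)[OF that], of l] rademacher_mgf[OF U v(2)[OF that], of "- l"] l2
      by (simp_all add: X_def)
    have "(\<Sum>B\<in>Pow U. \<Sum>x\<in>L. exp (l * X x B) + exp (l * - X x B)) =
        (\<Sum>x\<in>L. (\<Sum>B\<in>Pow U. exp (l * X x B)) + (\<Sum>B\<in>Pow U. exp (l * - X x B)))"
      by (subst sum.swap) (simp add: sum.distrib)
    also have "\<dots> \<le> (\<Sum>x\<in>L. 2 ^ card U * exp h + 2 ^ card U * exp h)"
      using one by (intro sum_mono add_mono) auto
    also have "\<dots> = (2 * real (card L)) * (2 ^ card U * exp h)" by simp
    also have "\<dots> \<le> exp h * (2 ^ card U * exp h)"
      using h by (intro mult_right_mono) auto
    finally have s: "(\<Sum>B\<in>Pow U. \<Sum>x\<in>L. exp (l * X x B) + exp (l * - X x B)) \<le> 2 ^ card U * exp (2 * h)"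
      by (simp add: exp_double power2_eq_square mult.left_commute)
    have "(\<Sum>B\<in>Pow U. Y B) = 2 ^ card U * a + (\<Sum>B\<in>Pow U. \<Sum>x\<in>L. exp (l * X x B) + exp (l * - X x B)) * exp (- (2 * h)) / l"
      using U by (simp add: Y_def sum.distrib card_Pow flip: sum_distrib_right sum_divide_distrib)
    also have "\<dots> \<le> 2 ^ card U * a + (2 ^ card U * exp (2 * h)) * exp (- (2 * h)) / l"
      using s l0 by (intro add_left_mono divide_right_mono mult_right_mono) auto
    also have "\<dots> = 2 ^ card U * (a + 1 / l)"
      by (simp add: distrib_left flip: exp_add)
    \<comment> \<open>Equivalent to \<open>1 <= l * a = 2 * h\<close>; this is where
      \<open>h >= 1/2\<close> enters.\<close>
    also have "1 / l \<le> a"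
      using la h l0 by (simp add: divide_le_eq mult.commute)
    finally show "(\<Sum>B\<in>Pow U. Y B) \<le> 2 ^ card U * (2 * sqrt (2 * v * h))"
      by (simp add: a_def)
  qed
qed

text \<open>A maximal separated subfamily is a net, since a member far from all of it could be
  added.\<close>

lemma ex_separated_net:
  fixes F :: "'a set set" and r :: real
  assumes "finite F" and r: "r \<ge> 0"
  shows "\<exists>G\<subseteq>F. (\<forall>D\<in>G. \<forall>E\<in>G. D \<noteq> E \<longrightarrow> real (card (sym_diff D E)) > r) \<and>
    (\<forall>E\<in>F. \<exists>D\<in>G. real (card (sym_diff E D)) \<le> r)"
proof -
  define sep where "sep = (\<lambda>G :: 'a set set. \<forall>D\<in>G. \<forall>E\<in>G. D \<noteq> E \<longrightarrow> real (card (sym_diff D E)) > r)"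
  have "finite {G. G \<subseteq> F \<and> sep G}" using assms by auto
  moreover have "{} \<in> {G. G \<subseteq> F \<and> sep G}" by (simp add: sep_def)
  ultimately have "\<exists>G\<in>{G. G \<subseteq> F \<and> sep G}. \<forall>H\<in>{G. G \<subseteq> F \<and> sep G}. G \<subseteq> H \<longrightarrow> G = H"
    by (intro finite_has_maximal) auto
  then obtain G where G: "G \<subseteq> F" "sep G" and max: "\<forall>H. H \<subseteq> F \<and> sep H \<longrightarrow> G \<subseteq> H \<longrightarrow> G = H"
    by auto
  have "\<exists>D\<in>G. real (card (sym_diff E D)) \<le> r" if E: "E \<in> F" for E
  proof (rule ccontr)
    assume no: "\<not> ?thesis"
    then have far: "real (card (sym_diff E D)) > r" "real (card (sym_diff D E)) > r" if "D \<in> G" for D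
      using that by (auto simp: not_le Un_commute)
    have "sep (insert E G)"
      using far G(2) unfolding sep_def by (intro ballI impI) (elim insertE; blast)
    moreover have "insert E G \<subseteq> F" using G(1) E by blast
    ultimately have "G = insert E G" using max by blast
    then have "E \<in> G" by (metis insertI1)
    with far(1)[of E] r show False by simp
  qed
  then show ?thesis using G unfolding sep_def by (intro exI[of _ G] conjI ballI) simp_all
qed

lemma sum_linear_geometric_le: "(\<Sum>k\<le>K. (real k + 1) / 2 ^ k) \<le> 4"
proof -
  have "(\<Sum>k\<le>K. (real k + 1) / 2 ^ k) = 4 - (real K + 3) / 2 ^ K"
    by (induction K) (simp_all add: field_simps)
  then show ?thesis by simp
qed

text \<open>
  Chaining: a member of \<open>F\<close> is reached through nets of radius \<open>card S / 4 ^ k\<close>, whose cardinalities are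
  at most \<open>exp (4 * \<nu> * (k + 1))\<close>.
\<close>

lemma rademacher_VC_class:
  fixes F :: "'a set set"
  assumes U: "finite U" and S: "S \<subseteq> U" and F: "F \<subseteq> Pow S"
    and VC: "\<And>A. finite A \<Longrightarrow> shatters F A \<Longrightarrow> card A \<le> \<nu>" and \<nu>: "\<nu> \<ge> 1"
  shows "\<exists>Y. (\<forall>B. \<forall>E\<in>F. \<bar>\<Sum>i\<in>E. sgn_of B i\<bar> \<le> Y B) \<and> (\<forall>B. 0 \<le> Y B) \<and>
    (\<Sum>B\<in>Pow U. Y B) \<le> 2 ^ card U * (48 * sqrt (real \<nu> * real (card S)))"
proof (cases "S = {} \<or> F = {}")
  case True
  then have "F \<subseteq> {{}}" using F by auto
  then show ?thesis by (intro exI[of _ "\<lambda>_. 0"]) auto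
next
  case False
  define s where "s = real (card S)"
  have finS: "finite S" using S U by (rule finite_subset)
  then have finF: "finite F" using F by (meson finite_Pow_iff finite_subset)
  have s0: "s > 0" using False finS by (simp add: s_def card_gt_0_iff)
  define r where "r = (\<lambda>k::nat. s / 4 ^ k)"
  have r0: "r k \<ge> 0" for k using s0 by (simp add: r_def)
  have "\<forall>k. \<exists>G\<subseteq>F. (\<forall>D\<in>G. \<forall>E\<in>G. D \<noteq> E \<longrightarrow> real (card (sym_diff D E)) > r k) \<and>
      (\<forall>E\<in>F. \<exists>D\<in>G. real (card (sym_diff E D)) \<le> r k)"
    using ex_separated_net[OF finF r0] by (rule allI)
  from choice[OF this] obtain G where G0: "\<forall>k. G k \<subseteq> F \<and>
      (\<forall>D\<in>G k. \<forall>E\<in>G k. D \<noteq> E \<longrightarrow> real (card (sym_diff D E)) > r k) \<and>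
      (\<forall>E\<in>F. \<exists>D\<in>G k. real (card (sym_diff E D)) \<le> r k)" by (elim exE)
  have G: "G k \<subseteq> F" "D \<in> G k \<Longrightarrow> E \<in> G k \<Longrightarrow> D \<noteq> E \<Longrightarrow> real (card (sym_diff D E)) > r k"
    "E \<in> F \<Longrightarrow> \<exists>D\<in>G k. real (card (sym_diff E D)) \<le> r k" for k D E
    using spec[OF G0, of k] by simp_all
  have Gne: "G k \<noteq> {}" for k using G(3)[of _ k] False by blast
  \<comment> \<open>The packing bound at separation \<open>1 / 4 ^ k\<close> gives
    \<open>1/2 + 2 * \<nu> * (k + 1) * ln 4\<close>, at most
    \<open>1/2 + 7/10 * h k\<close>.\<close>
  define h where "h = (\<lambda>k::nat. 4 * real \<nu> * (real k + 1))"
  have h4: "h k \<ge> 4" for k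
  proof -
    have "1 * 1 \<le> real \<nu> * (real k + 1)" using \<nu> by (intro mult_mono) auto
    then show ?thesis by (simp add: h_def)
  qed
  have cG: "2 * real (card (G k)) \<le> exp (h k)" for k
  proof -
    have finG: "finite (G k)" using G(1) finF by (rule finite_subset)
    then have c0: "card (G k) > 0" using Gne by (simp add: card_gt_0_iff)
    have "ln (real (card (G k))) \<le> 1/2 + 2 * real \<nu> * ln (4 / (1 / 4 ^ k))"
    proof (rule packing_bound[OF finS, of "G k"])
      show "G k \<subseteq> Pow S" using G(1) F by blast
      show "card A \<le> \<nu>" if "finite A" "shatters (G k) A" for A
      proof (rule VC[OF that(1)])
        show "shatters F A" using G(1) that(2) by (rule shatters_mono)
      qed
      show "(1::real) / 4 ^ k \<le> 1" by simp
      show "1 / 4 ^ k * real (card S) < real (card (sym_diff D E))" if "D \<in> G k" "E \<in> G k" "D \<noteq> E" for D E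
        using G(2)[OF that] by (simp add: r_def s_def)
    qed (use Gne in auto)
    also have "ln (4 / (1 / 4 ^ k)) = (real k + 1) * ln (4::real)"
      using ln_realpow[of "4::real" "Suc k"] by simp
    also have "1/2 + 2 * real \<nu> * ((real k + 1) * ln 4) \<le> 1/2 + 2 * real \<nu> * ((real k + 1) * (7/5))"
      using ln4_le by (intro add_left_mono mult_left_mono) auto
    also have "\<dots> = 1/2 + (7/10) * h k" by (simp add: h_def)
    finally have "ln (real (card (G k))) \<le> 1/2 + (7/10) * h k" .
    then have "ln 2 + ln (real (card (G k))) \<le> h k"
      using h4[of k] ln2_le_25_over_36 by linarith
    then have "ln (2 * real (card (G k))) \<le> h k" using c0 by (simp add: ln_mult)
    then show ?thesis using c0 by (metis exp_le_cancel_iff exp_ln mult_pos_pos of_nat_0_less_iff zero_less_numeral)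
  qed
  define p where "p = (\<lambda>k E. SOME D. D \<in> G k \<and> real (card (sym_diff E D)) \<le> r k)"
  have pp: "p k E \<in> G k \<and> real (card (sym_diff E (p k E))) \<le> r k" if "E \<in> F" for k E
    unfolding p_def by (rule someI_ex) (use G(3)[OF that, of k] in \<open>simp only: Bex_def\<close>)
  have p: "p k E \<in> G k" "real (card (sym_diff E (p k E))) \<le> r k" if "E \<in> F" for k E
    using pp[OF that, of k] by (rule conjunct1, rule conjunct2)
  \<comment> \<open>Predecessor in the chain: net \<open>k - 1\<close> for positive
    \<open>k\<close>, the empty set at the start. Since
    \<open>s / 4 ^ (k - 1) = 4 * s / 4 ^ k\<close>, the bound \<open>v k\<close> below fits every
    link, with room to spare at \<open>k = 0\<close>.\<close>
  define q where "q = (\<lambda>k E. if k = 0 then {} else p (k - 1) E)"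
  define w where "w = (\<lambda>k E i. indicator E i - indicator (q k E) i :: real)"
  define X where "X = (\<lambda>E B. \<Sum>i\<in>U. indicator E i * sgn_of B i)"
  define v where "v = (\<lambda>k::nat. 4 * s / 4 ^ k)"
  have ind: "(\<Sum>i\<in>U. indicator T i) = real (card (U \<inter> T))" for T :: "'a set"
    using U by (simp add: indicator_def sum.If_cases)
  have EU: "E \<subseteq> U" if "E \<in> F" for E using that F S by auto
  have qU: "q k E \<subseteq> U" if "E \<in> F" for k E
    using EU p(1)[OF that, of "k - 1"] G(1) by (auto simp: q_def)
  have wv: "(\<Sum>i\<in>U. (w k E i)\<^sup>2) \<le> v k" if E: "E \<in> G k" for k E
  proof -
    have EF: "E \<in> F" using E G(1) by blast
    have "(\<Sum>i\<in>U. (w k E i)\<^sup>2) = (\<Sum>i\<in>U. indicator (sym_diff E (q k E)) i)"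
      by (intro sum.cong) (auto simp: w_def indicator_def)
    also have "\<dots> = real (card (U \<inter> sym_diff E (q k E)))"
      by (rule ind)
    also have "U \<inter> sym_diff E (q k E) = sym_diff E (q k E)"
      using EU[OF EF] qU[OF EF] by blast
    also have "real (card \<dots>) \<le> v k"
    proof (cases k)
      case 0
      have "card E \<le> card S" using EF F finS by (intro card_mono) auto
      then show ?thesis using 0 s0 by (simp add: q_def v_def s_def)
    next
      case (Suc j)
      then show ?thesis using p(2)[OF EF, of j] by (simp add: q_def v_def r_def)
    qed
    finally show ?thesis .
  qed
  have "\<forall>k. \<exists>Y. (\<forall>B. \<forall>E\<in>G k. \<bar>\<Sum>i\<in>U. w k E i * sgn_of B i\<bar> \<le> Y B) \<and> (\<forall>B. 0 \<le> Y B) \<and>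
      (\<Sum>B\<in>Pow U. Y B) \<le> 2 ^ card U * (2 * sqrt (2 * v k * h k))"
  proof
    fix k
    show "\<exists>Y. (\<forall>B. \<forall>E\<in>G k. \<bar>\<Sum>i\<in>U. w k E i * sgn_of B i\<bar> \<le> Y B) \<and> (\<forall>B. 0 \<le> Y B) \<and>
      (\<Sum>B\<in>Pow U. Y B) \<le> 2 ^ card U * (2 * sqrt (2 * v k * h k))"
    proof (rule rademacher_maximal[OF U])
      show "finite (G k)" using G(1) finF by (rule finite_subset)
      show "v k > 0" using s0 by (simp add: v_def)
      show "h k \<ge> 1/2" using h4[of k] by linarith
    qed (rule wv cG, assumption?)+
  qed
  from choice[OF this] obtain Y where Y0: "\<forall>k. (\<forall>B. \<forall>E\<in>G k. \<bar>\<Sum>i\<in>U. w k E i * sgn_of B i\<bar> \<le> Y k B) \<and>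
      (\<forall>B. 0 \<le> Y k B) \<and> (\<Sum>B\<in>Pow U. Y k B) \<le> 2 ^ card U * (2 * sqrt (2 * v k * h k))" by (elim exE)
  have Y: "E \<in> G k \<Longrightarrow> \<bar>\<Sum>i\<in>U. w k E i * sgn_of B i\<bar> \<le> Y k B" "0 \<le> Y k B"
      "(\<Sum>B\<in>Pow U. Y k B) \<le> 2 ^ card U * (2 * sqrt (2 * v k * h k))" for k B E
    using spec[OF Y0, of k] by simp_all
  have chain: "\<bar>X E B\<bar> \<le> (\<Sum>j\<le>k. Y j B)" if "E \<in> G k" for k E B
    using that
  proof (induction k arbitrary: E)
    case 0
    have "X E B = (\<Sum>i\<in>U. w 0 E i * sgn_of B i)" by (simp add: X_def w_def q_def)
    then show ?case using Y(1)[OF 0] by simp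
  next
    case (Suc k)
    have EF: "E \<in> F" using Suc.prems G(1) by blast
    have "X E B = X (p k E) B + (\<Sum>i\<in>U. w (Suc k) E i * sgn_of B i)"
      by (simp add: X_def w_def q_def sum.distrib[symmetric] left_diff_distrib)
    then show ?case using Y(1)[OF Suc.prems, of B] Suc.IH[OF p(1)[OF EF]] by simp
  qed
  \<comment> \<open>Once the radius is below 1, a member of \<open>F\<close> equals its nearest net
    element, so the chain is finite.\<close>
  obtain K where K: "s < 4 ^ K" using real_arch_pow[of 4 s] by auto
  have FG: "F \<subseteq> G K"
  proof
    fix E assume E: "E \<in> F"
    have "sym_diff E (p K E) \<subseteq> U" using EU[OF E] EU[of "p K E"] p(1)[OF E] G(1) by blast
    then have fin: "finite (sym_diff E (p K E))" using U by (rule finite_subset)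
    have "real (card (sym_diff E (p K E))) \<le> r K" by (rule p(2)[OF E])
    also have "\<dots> < 1" using K by (simp add: r_def)
    finally have "sym_diff E (p K E) = {}" using fin by simp
    then have "E = p K E" by blast
    then show "E \<in> G K" using p(1)[OF E, of K] by simp
  qed
  show ?thesis
  proof (intro exI[of _ "\<lambda>B. \<Sum>j\<le>K. Y j B"] conjI allI ballI)
    show "\<bar>\<Sum>i\<in>E. sgn_of B i\<bar> \<le> (\<Sum>j\<le>K. Y j B)" if "E \<in> F" for B E
    proof -
      have "X E B = (\<Sum>i\<in>U \<inter> E. sgn_of B i)"
        using U by (simp add: X_def sum.inter_restrict indicator_def if_distrib cong: if_cong)
      also have "U \<inter> E = E" using EU[OF that] by auto
      finally show ?thesis using chain[of E K B] FG that by auto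
    qed
    show "0 \<le> (\<Sum>j\<le>K. Y j B)" for B using Y(2) by (intro sum_nonneg) auto
    have "(\<Sum>B\<in>Pow U. \<Sum>j\<le>K. Y j B) = (\<Sum>j\<le>K. \<Sum>B\<in>Pow U. Y j B)" by (rule sum.swap)
    also have "\<dots> \<le> (\<Sum>j\<le>K. 2 ^ card U * (12 * sqrt (real \<nu> * s) * ((real j + 1) / 2 ^ j)))"
    proof (rule sum_mono)
      fix j
      have "sqrt (2 * v j * h j) = sqrt (32 * (real \<nu> * s) * ((real j + 1) / 4 ^ j))"
        by (simp add: v_def h_def field_simps)
      \<comment> \<open>Rounding up to squares: the root becomes \<open>6 * (j + 1) / 2 ^ j\<close>.
        Doubled and summed with the geometric bound 4, this gives the constant 48.\<close>
      also have "\<dots> \<le> sqrt (36 * (real \<nu> * s) * ((real j + 1)\<^sup>2 / 4 ^ j))"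
      proof (intro real_sqrt_le_mono mult_mono divide_right_mono)
        show "real j + 1 \<le> (real j + 1)\<^sup>2" by (simp add: power2_eq_square)
      qed (use s0 in auto)
      also have "\<dots> = 6 * sqrt (real \<nu> * s) * ((real j + 1) / 2 ^ j)"
      proof -
        have "sqrt (4 ^ j) = (2::real) ^ j" by (simp add: real_sqrt_power)
        moreover have "sqrt 36 = (6::real)" by (rule real_sqrt_unique) auto
        ultimately show ?thesis by (simp add: real_sqrt_mult real_sqrt_divide)
      qed
      finally have "2 * sqrt (2 * v j * h j) \<le> 12 * sqrt (real \<nu> * s) * ((real j + 1) / 2 ^ j)" by simp
      then have "2 ^ card U * (2 * sqrt (2 * v j * h j)) \<le> 2 ^ card U * (12 * sqrt (real \<nu> * s) * ((real j + 1) / 2 ^ j))"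
        by (intro mult_left_mono) auto
      then show "(\<Sum>B\<in>Pow U. Y j B) \<le> 2 ^ card U * (12 * sqrt (real \<nu> * s) * ((real j + 1) / 2 ^ j))"
        using Y(3)[of j] by linarith
    qed
    also have "\<dots> = 2 ^ card U * (12 * sqrt (real \<nu> * s) * (\<Sum>j\<le>K. (real j + 1) / 2 ^ j))"
      by (simp add: sum_distrib_left)
    also have "\<dots> \<le> 2 ^ card U * (12 * sqrt (real \<nu> * s) * 4)"
      using s0 sum_linear_geometric_le by (intro mult_left_mono) auto
    finally show "(\<Sum>B\<in>Pow U. \<Sum>j\<le>K. Y j B) \<le> 2 ^ card U * (48 * sqrt (real \<nu> * real (card S)))"
      by (simp add: s_def)
  qed
qed

section \<open>Sampling by repeated halving\<close>

definition samp :: "(nat \<Rightarrow> 'a set) \<Rightarrow> nat \<Rightarrow> 'a set \<Rightarrow> 'a set" where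
  "samp B j A = {i \<in> A. \<forall>k<j. i \<in> B k}"

lemma samp_0 [simp]: "samp B 0 A = A" by (simp add: samp_def)

lemma samp_Suc: "samp B (Suc j) A = samp B j A \<inter> B j"
  by (auto simp: samp_def less_Suc_eq)

lemma samp_subset: "samp B j A \<subseteq> A" by (auto simp: samp_def)

text \<open>Level \<open>j\<close> reads only the rounds before \<open>j\<close>, hence it is
  independent of round \<open>j\<close>.\<close>

lemma samp_upd: "samp (B(j := Y)) j A = samp B j A" by (auto simp: samp_def)

section \<open>Averaging over the coin tosses\<close>

definition coins :: "nat \<Rightarrow> 'a set \<Rightarrow> (nat \<Rightarrow> 'a set) pmf" where
  "coins J U = Pi_pmf {..<J} {} (\<lambda>_. pmf_of_set (Pow U))"

lemma finite_set_coins: "finite U \<Longrightarrow> finite (set_pmf (coins J U))"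
  unfolding coins_def
  by (rule finite_subset[OF set_Pi_pmf_subset']) (auto intro!: finite_PiE_dflt simp: set_pmf_of_set Pow_not_empty)

lemma expectation_bind_finite:
  fixes h :: "'b \<Rightarrow> real"
  assumes "finite (set_pmf p)" "\<And>x. x \<in> set_pmf p \<Longrightarrow> finite (set_pmf (f x))"
  shows "measure_pmf.expectation (bind_pmf p f) h =
    measure_pmf.expectation p (\<lambda>x. measure_pmf.expectation (f x) h)"
  using assms
  by (subst pmf_expectation_bind[of "set_pmf p"], simp_all, subst integral_measure_pmf[of "set_pmf p"], simp_all)

text \<open>Conditional expectation given all other rounds: round \<open>j\<close> is averaged out
  while level \<open>j\<close> stays fixed.\<close>

lemma expectation_coins_level:
  fixes h :: "'a set \<Rightarrow> 'a set \<Rightarrow> real"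
  assumes U: "finite U" and j: "j < J"
  shows "measure_pmf.expectation (coins J U) (\<lambda>B. h (samp B j A) (B j)) =
    measure_pmf.expectation (coins J U) (\<lambda>B. (\<Sum>Y\<in>Pow U. h (samp B j A) Y) / 2 ^ card U)"
proof -
  define Q where "Q = Pi_pmf ({..<J} - {j}) {} (\<lambda>_. pmf_of_set (Pow U))"
  have fin: "finite (set_pmf Q)" unfolding Q_def
    by (rule finite_subset[OF set_Pi_pmf_subset'])
       (use U in \<open>auto intro!: finite_PiE_dflt simp: set_pmf_of_set Pow_not_empty\<close>)
  have ins: "{..<J} = insert j ({..<J} - {j})" using j by auto
  have "coins J U = do {y \<leftarrow> pmf_of_set (Pow U); f \<leftarrow> Q; return_pmf (f(j := y))}"
    unfolding coins_def Q_def by (subst ins, subst Pi_pmf_insert') auto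
  also have "\<dots> = do {f \<leftarrow> Q; y \<leftarrow> pmf_of_set (Pow U); return_pmf (f(j := y))}"
    by (rule bind_commute_pmf)
  finally have Q: "coins J U = do {f \<leftarrow> Q; y \<leftarrow> pmf_of_set (Pow U); return_pmf (f(j := y))}" .
  have *: "measure_pmf.expectation (coins J U) g =
      measure_pmf.expectation Q (\<lambda>f. (\<Sum>y\<in>Pow U. g (f(j := y))) / 2 ^ card U)" for g :: "_ \<Rightarrow> real"
  proof -
    have outer: "measure_pmf.expectation (coins J U) g = measure_pmf.expectation Q
        (\<lambda>f. measure_pmf.expectation (pmf_of_set (Pow U) \<bind> (\<lambda>y. return_pmf (f(j := y)))) g)"
      unfolding Q by (rule expectation_bind_finite) (use fin U in \<open>auto simp: set_pmf_of_set Pow_not_empty\<close>)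
    have inner: "measure_pmf.expectation (pmf_of_set (Pow U) \<bind> (\<lambda>y. return_pmf (f(j := y)))) g =
        (\<Sum>y\<in>Pow U. g (f(j := y))) / 2 ^ card U" for f
      using U by (subst expectation_bind_finite) (auto simp: set_pmf_of_set Pow_not_empty integral_pmf_of_set card_Pow)
    show ?thesis by (simp only: outer inner)
  qed
  \<comment> \<open>Both sides are expanded by averaging coordinate \<open>j\<close>. On the right
    the integrand ignores that coordinate, so \<open>2 ^ card U\<close> equal terms are
    averaged.\<close>
  show ?thesis
    unfolding * samp_upd using U by (simp add: card_Pow)
qed

text \<open>Each subset is paired with its complement.\<close>

lemma sum_card_Int_Pow:
  assumes U: "finite U" and S: "S \<subseteq> U"
  shows "(\<Sum>Y\<in>Pow U. real (card (S \<inter> Y))) = 2 ^ card U * (real (card S) / 2)"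
proof -
  have compl: "(\<Sum>Y\<in>Pow U. real (card (S \<inter> Y))) = (\<Sum>Y\<in>Pow U. real (card (S \<inter> (U - Y))))"
    by (rule sum.reindex_bij_witness[of _ "\<lambda>Y. U - Y" "\<lambda>Y. U - Y"]) (auto simp: double_diff)
  have cmp: "real (card (S \<inter> Y)) + real (card (S \<inter> (U - Y))) = real (card S)" if "Y \<in> Pow U" for Y
  proof -
    have "S \<inter> Y \<union> S \<inter> (U - Y) = S" using S by auto
    moreover have "card (S \<inter> Y \<union> S \<inter> (U - Y)) = card (S \<inter> Y) + card (S \<inter> (U - Y))"
      using finite_subset[OF S U] by (intro card_Un_disjoint) auto
    ultimately show ?thesis by simp
  qed
  have "(\<Sum>Y\<in>Pow U. real (card (S \<inter> Y))) + (\<Sum>Y\<in>Pow U. real (card (S \<inter> Y))) =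
    (\<Sum>Y\<in>Pow U. real (card (S \<inter> Y)) + real (card (S \<inter> (U - Y))))"
    by (simp only: sum.distrib flip: compl)
  also have "\<dots> = (\<Sum>Y\<in>Pow U. real (card S))"
    using cmp by (intro sum.cong) auto
  finally show ?thesis using U by (simp add: card_Pow)
qed

lemma expectation_card_samp:
  assumes U: "finite U" and A: "A \<subseteq> U" and "j \<le> J"
  shows "measure_pmf.expectation (coins J U) (\<lambda>B. real (card (samp B j A))) = real (card A) / 2 ^ j"
  using \<open>j \<le> J\<close>
proof (induction j)
  case (Suc j)
  have "measure_pmf.expectation (coins J U) (\<lambda>B. real (card (samp B j A \<inter> B j))) =
      measure_pmf.expectation (coins J U) (\<lambda>B. (\<Sum>Y\<in>Pow U. real (card (samp B j A \<inter> Y))) / 2 ^ card U)"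
    using Suc.prems by (intro expectation_coins_level[OF U, where h = "\<lambda>S Y. real (card (S \<inter> Y))"]) auto
  also have "\<dots> = measure_pmf.expectation (coins J U) (\<lambda>B. real (card (samp B j A)) / 2)"
    by (subst sum_card_Int_Pow[OF U]) (use A samp_subset in \<open>auto simp: samp_def\<close>)
  also have "\<dots> = real (card A) / 2 ^ Suc j" using Suc by simp
  finally show ?case by (simp add: samp_Suc)
qed simp

text \<open>Jensen's inequality through the tangent of the square root at the mean:
  \<open>y <= y\<^sup>2 / (2 * a) + a / 2\<close>. Nonemptiness of \<open>A\<close> makes
  \<open>a\<close> positive.\<close>

lemma expectation_sqrt_card_samp:
  assumes U: "finite U" and A: "A \<subseteq> U" "A \<noteq> {}" and "j \<le> J"
  shows "measure_pmf.expectation (coins J U) (\<lambda>B. sqrt (real (card (samp B j A)))) \<le> sqrt (real (card A) / 2 ^ j)"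
proof -
  define a where "a = sqrt (real (card A) / 2 ^ j)"
  have "card A > 0" using A U by (simp add: card_gt_0_iff finite_subset)
  then have a: "a > 0" "a * a = real (card A) / 2 ^ j" by (simp_all add: a_def)
  have int: "integrable (measure_pmf (coins J U)) f" for f :: "_ \<Rightarrow> real"
    by (rule integrable_measure_pmf_finite[OF finite_set_coins[OF U]])
  have "measure_pmf.expectation (coins J U) (\<lambda>B. sqrt (real (card (samp B j A))))
    \<le> measure_pmf.expectation (coins J U) (\<lambda>B. real (card (samp B j A)) / (2 * a) + a / 2)"
  proof (rule integral_mono[OF int int])
    fix B
    define y where "y = sqrt (real (card (samp B j A)))"
    have "0 \<le> (y - a)\<^sup>2" by simp
    then have "2 * a * y \<le> y\<^sup>2 + a * a" by (simp add: power2_eq_square algebra_simps)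
    then have "y \<le> (y\<^sup>2 + a * a) / (2 * a)" using a by (simp add: pos_le_divide_eq mult_ac)
    also have "\<dots> = y\<^sup>2 / (2 * a) + a / 2" using a(1) by (simp add: add_divide_distrib)
    finally show "sqrt (real (card (samp B j A))) \<le> real (card (samp B j A)) / (2 * a) + a / 2"
      by (simp add: y_def)
  qed
  also have "\<dots> = real (card A) / 2 ^ j / (2 * a) + a / 2"
    using expectation_card_samp[OF U A(1) \<open>j \<le> J\<close>] by (simp add: int)
  also have "\<dots> = a" using a by (simp flip: a(2))
  finally show ?thesis by (simp add: a_def)
qed

text \<open>A set shattered by traces on \<open>S\<close> lies inside \<open>S\<close>, so
  intersecting with \<open>S\<close> changes nothing on it.\<close>

lemma shatters_trace: "shatters ((\<lambda>E. E \<inter> S) ` F) T \<Longrightarrow> shatters F T"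
proof -
  assume sh: "shatters ((\<lambda>E. E \<inter> S) ` F) T"
  then obtain E where "T \<inter> (E \<inter> S) = T" unfolding shatters_def by blast
  then have "T \<inter> (E \<inter> S) = T \<inter> E" for E by blast
  then show "shatters F T" using sh by (simp add: shatters_def)
qed

text \<open>The deviation at level \<open>j\<close> telescopes into terms \<open>2 ^ i\<close> times
  the signed sum over \<open>E\<close> cut down to level \<open>i\<close>. That level has about
  \<open>card A / 2 ^ i\<close> elements, so chaining bounds the term by order
  \<open>2 ^ i / sqrt (2 ^ i) = sqrt 2 ^ i\<close>. The majorants are nonnegative, so one
  \<open>D\<close> serves all levels up to \<open>j0\<close>.\<close>

lemma samp_deviation:
  fixes F :: "'a set set"
  assumes U: "finite U" and A: "A \<subseteq> U" "A \<noteq> {}" and F: "F \<subseteq> Pow A"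
    and VC: "\<And>T. finite T \<Longrightarrow> shatters F T \<Longrightarrow> card T \<le> \<nu>" and \<nu>: "\<nu> \<ge> 1" and j0: "j0 \<le> J"
  shows "\<exists>D. (\<forall>B. \<forall>E\<in>F. \<forall>j\<le>j0. \<bar>real (card E) - 2 ^ j * real (card (E \<inter> samp B j A))\<bar> \<le> D B) \<and>
    (\<forall>B. 0 \<le> D B) \<and>
    measure_pmf.expectation (coins J U) D \<le> 48 * sqrt (real \<nu> * real (card A)) * (\<Sum>i<j0. sqrt 2 ^ i)"
proof -
  \<comment> \<open>A majorant is fixed for every \<open>S\<close> in advance, because it will be
    evaluated at the random set \<open>samp B i A\<close>. The premise
    \<open>S \<subseteq> A\<close> stands under the existential so that choice yields a total
    function.\<close>
  have "\<forall>S. \<exists>Y. S \<subseteq> A \<longrightarrow> (\<forall>B. \<forall>E\<in>(\<lambda>E. E \<inter> S) ` F. \<bar>\<Sum>i\<in>E. sgn_of B i\<bar> \<le> Y B) \<and> (\<forall>B. 0 \<le> Y B) \<and>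
    (\<Sum>B\<in>Pow U. Y B) \<le> 2 ^ card U * (48 * sqrt (real \<nu> * real (card S)))"
  proof (intro allI)
    fix S
    show "\<exists>Y. S \<subseteq> A \<longrightarrow> (\<forall>B. \<forall>E\<in>(\<lambda>E. E \<inter> S) ` F. \<bar>\<Sum>i\<in>E. sgn_of B i\<bar> \<le> Y B) \<and> (\<forall>B. 0 \<le> Y B) \<and>
      (\<Sum>B\<in>Pow U. Y B) \<le> 2 ^ card U * (48 * sqrt (real \<nu> * real (card S)))"
    proof (cases "S \<subseteq> A")
      case True
      have "\<exists>Y. (\<forall>B. \<forall>E\<in>(\<lambda>E. E \<inter> S) ` F. \<bar>\<Sum>i\<in>E. sgn_of B i\<bar> \<le> Y B) \<and> (\<forall>B. 0 \<le> Y B) \<and>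
        (\<Sum>B\<in>Pow U. Y B) \<le> 2 ^ card U * (48 * sqrt (real \<nu> * real (card S)))"
      proof (rule rademacher_VC_class[OF U _ _ _ \<nu>])
        show "S \<subseteq> U" using True A by blast
        show "card T \<le> \<nu>" if T: "finite T" "shatters ((\<lambda>E. E \<inter> S) ` F) T" for T
        proof (rule VC[OF T(1) shatters_trace[OF T(2)]])
        qed
      qed auto
      then show ?thesis by blast
    qed simp
  qed
  from choice[OF this] obtain Y where Y0: "\<forall>S. S \<subseteq> A \<longrightarrow> (\<forall>B. \<forall>E\<in>(\<lambda>E. E \<inter> S) ` F. \<bar>\<Sum>i\<in>E. sgn_of B i\<bar> \<le> Y S B) \<and>
    (\<forall>B. 0 \<le> Y S B) \<and> (\<Sum>B\<in>Pow U. Y S B) \<le> 2 ^ card U * (48 * sqrt (real \<nu> * real (card S)))"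
    by (elim exE)
  have Y: "E \<in> F \<Longrightarrow> \<bar>\<Sum>i\<in>E \<inter> S. sgn_of B i\<bar> \<le> Y S B" "0 \<le> Y S B"
    "(\<Sum>B\<in>Pow U. Y S B) \<le> 2 ^ card U * (48 * sqrt (real \<nu> * real (card S)))" if "S \<subseteq> A" for S B E
    using Y0 that by blast+
  have int: "integrable (measure_pmf (coins J U)) f" for f :: "_ \<Rightarrow> real"
    by (rule integrable_measure_pmf_finite[OF finite_set_coins[OF U]])
  define D where "D = (\<lambda>B. \<Sum>i<j0. 2 ^ i * Y (samp B i A) (B i))"
  have nonneg: "0 \<le> 2 ^ i * Y (samp B i A) (B i)" for i B
    using Y(2)[OF samp_subset] by simp
  have part: "\<bar>real (card E) - 2 ^ j * real (card (E \<inter> samp B j A))\<bar> \<le> (\<Sum>i<j. 2 ^ i * Y (samp B i A) (B i))"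
    if E: "E \<in> F" for E B j
  proof (induction j)
    case 0
    have "E \<inter> A = E" using E F by auto
    then show ?case by simp
  next
    case (Suc j)
    let ?S = "samp B j A"
    have fin: "finite (E \<inter> ?S)" using U A samp_subset by (meson finite_Int finite_subset)
    have "(\<Sum>i\<in>E \<inter> ?S. sgn_of (B j) i) = (\<Sum>i\<in>E \<inter> ?S. 1 - 2 * indicator (B j) i)"
      by (intro sum.cong) (auto simp: sgn_of_def)
    also have "\<dots> = real (card (E \<inter> ?S)) - 2 * (\<Sum>i\<in>E \<inter> ?S. indicator (B j) i)"
      by (simp add: sum_subtractf sum_distrib_left)
    also have "(\<Sum>i\<in>E \<inter> ?S. indicator (B j) i) = real (card (E \<inter> samp B (Suc j) A))"
      using fin by (simp add: indicator_def sum.If_cases samp_Suc Int_assoc)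
    finally have s: "(\<Sum>i\<in>E \<inter> ?S. sgn_of (B j) i) = real (card (E \<inter> ?S)) - 2 * real (card (E \<inter> samp B (Suc j) A))" .
    have "real (card E) - 2 ^ Suc j * real (card (E \<inter> samp B (Suc j) A)) =
      (real (card E) - 2 ^ j * real (card (E \<inter> ?S))) + 2 ^ j * (\<Sum>i\<in>E \<inter> ?S. sgn_of (B j) i)"
      unfolding s by (simp add: algebra_simps)
    moreover have "\<bar>2 ^ j * (\<Sum>i\<in>E \<inter> ?S. sgn_of (B j) i)\<bar> \<le> 2 ^ j * Y ?S (B j)"
      using Y(1)[OF samp_subset[of B j A] E, of "B j"] by (simp add: abs_mult)
    ultimately show ?case using Suc.IH by simp
  qed
  show ?thesis
  proof (intro exI[of _ D] conjI allI ballI impI)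
    fix B E j assume "E \<in> F" "j \<le> j0"
    have "(\<Sum>i<j. 2 ^ i * Y (samp B i A) (B i)) \<le> D B"
      unfolding D_def using nonneg \<open>j \<le> j0\<close> by (intro sum_mono2) auto
    with part[OF \<open>E \<in> F\<close>, of j B] show "\<bar>real (card E) - 2 ^ j * real (card (E \<inter> samp B j A))\<bar> \<le> D B"
      by linarith
  next
    show "0 \<le> D B" for B unfolding D_def using nonneg by (intro sum_nonneg) auto
  next
    have one: "measure_pmf.expectation (coins J U) (\<lambda>B. 2 ^ i * Y (samp B i A) (B i))
        \<le> 48 * sqrt (real \<nu> * real (card A)) * sqrt 2 ^ i" if i: "i < j0" for i
    proof -
      have "measure_pmf.expectation (coins J U) (\<lambda>B. Y (samp B i A) (B i)) =
        measure_pmf.expectation (coins J U) (\<lambda>B. (\<Sum>T\<in>Pow U. Y (samp B i A) T) / 2 ^ card U)"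
        using i j0 by (intro expectation_coins_level[OF U]) auto
      also have "\<dots> \<le> measure_pmf.expectation (coins J U) (\<lambda>B. 48 * sqrt (real \<nu>) * sqrt (real (card (samp B i A))))"
      proof (rule integral_mono[OF int int])
        fix B
        show "(\<Sum>T\<in>Pow U. Y (samp B i A) T) / 2 ^ card U \<le> 48 * sqrt (real \<nu>) * sqrt (real (card (samp B i A)))"
          using Y(3)[OF samp_subset[of B i A]] by (simp add: pos_divide_le_eq real_sqrt_mult mult_ac)
      qed
      also have "\<dots> = 48 * sqrt (real \<nu>) * measure_pmf.expectation (coins J U) (\<lambda>B. sqrt (real (card (samp B i A))))"
        by (rule integral_mult_right_zero)
      also have "\<dots> \<le> 48 * sqrt (real \<nu>) * sqrt (real (card A) / 2 ^ i)"
        using i j0 by (intro mult_left_mono expectation_sqrt_card_samp U A) auto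
      finally have "2 ^ i * measure_pmf.expectation (coins J U) (\<lambda>B. Y (samp B i A) (B i)) \<le>
        2 ^ i * (48 * sqrt (real \<nu>) * sqrt (real (card A) / 2 ^ i))" by simp
      also have "\<dots> = 48 * sqrt (real \<nu> * real (card A)) * sqrt 2 ^ i"
      proof -
        have "(2::real) ^ i = sqrt 2 ^ i * sqrt 2 ^ i" by (simp flip: power_mult_distrib)
        then show ?thesis by (simp add: real_sqrt_mult real_sqrt_divide real_sqrt_power)
      qed
      finally show ?thesis by simp
    qed
    have "measure_pmf.expectation (coins J U) D =
        (\<Sum>i<j0. measure_pmf.expectation (coins J U) (\<lambda>B. 2 ^ i * Y (samp B i A) (B i)))"
      unfolding D_def by (rule Bochner_Integration.integral_sum[OF int])
    also have "\<dots> \<le> (\<Sum>i<j0. 48 * sqrt (real \<nu> * real (card A)) * sqrt 2 ^ i)"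
      using one by (intro sum_mono) auto
    finally show "measure_pmf.expectation (coins J U) D \<le> 48 * sqrt (real \<nu> * real (card A)) * (\<Sum>i<j0. sqrt 2 ^ i)"
      by (simp add: sum_distrib_left)
  qed
qed

text \<open>The constant 3 survives the induction step because \<open>1 + 3 <= 3 * sqrt 2\<close>,
  that is, \<open>sqrt 2 >= 4/3\<close>.\<close>

lemma sum_sqrt2_le: "(\<Sum>i<j. sqrt 2 ^ i) \<le> 3 * sqrt 2 ^ j"
proof -
  have s: "sqrt 2 \<ge> (4/3 :: real)" by (rule real_le_rsqrt) (simp add: power2_eq_square)
  show ?thesis
  proof (induction j)
    case (Suc j)
    have "4/3 * sqrt 2 ^ j \<le> sqrt 2 * sqrt 2 ^ j"
      by (rule mult_right_mono[OF s]) simp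
    then have "sqrt 2 ^ j + 3 * sqrt 2 ^ j \<le> 3 * sqrt 2 ^ Suc j" unfolding power_Suc by linarith
    with Suc show ?case unfolding sum.lessThan_Suc by linarith
  qed simp
qed

text \<open>A query reads the lowest level with fewer than \<open>K\<close> active items. The first
  condition forces this level to be at most \<open>j0\<close>, and the second makes every level up
  to \<open>j0\<close> accurate. The tolerance is halved because comparing the answer with the
  optimum uses it twice.\<close>

definition good_coins :: "real \<Rightarrow> real \<Rightarrow> nat \<Rightarrow> 'a set \<Rightarrow> 'a set set \<Rightarrow> (nat \<Rightarrow> 'a set) set" where
  "good_coins K \<epsilon> J A F = {B. \<exists>j0\<le>J. real (card (samp B j0 A)) < K \<and>
     (\<forall>E\<in>F. \<forall>j\<le>j0. \<bar>real (card E) - 2 ^ j * real (card (E \<inter> samp B j A))\<bar> \<le> \<epsilon> * real (card A) / 2)}"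

text \<open>
  The level \<open>j0\<close> is the least one whose expected sample size is at most \<open>K / 32\<close>.  The constant is
  \<open>73728 = 48 * 3 * 8 * 64\<close>, with \<open>48\<close> from the chaining bound, \<open>3\<close> from the geometric sum over the
  levels, \<open>8 = sqrt 64\<close> from the choice of \<open>j0\<close>, and \<open>64\<close> from Markov's inequality.
\<close>

lemma prob_good_coins:
  fixes F :: "'a set set" and K \<epsilon> :: real
  assumes U: "finite U" and A: "A \<subseteq> U" "A \<noteq> {}" and F: "F \<subseteq> Pow A"
    and VC: "\<And>T. finite T \<Longrightarrow> shatters F T \<Longrightarrow> card T \<le> \<nu>" and \<nu>: "\<nu> \<ge> 1"
    and \<epsilon>: "0 < \<epsilon>" "\<epsilon> < 1" and K: "K \<ge> 73728\<^sup>2 * (real \<nu> / \<epsilon>\<^sup>2)" and J: "card A \<le> 2 ^ J"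
  shows "measure_pmf.prob (coins J U) (good_coins K \<epsilon> J A F) \<ge> 15/16"
proof -
  define N where "N = real (card A)"
  have N0: "N > 0" using A U by (simp add: N_def card_gt_0_iff finite_subset)
  have "1 \<le> real \<nu> / \<epsilon>\<^sup>2"
    using \<nu> \<epsilon> power_mono[of \<epsilon> 1 2] by (simp add: pos_le_divide_eq)
  then have "73728\<^sup>2 * 1 \<le> 73728\<^sup>2 * (real \<nu> / \<epsilon>\<^sup>2)" by (intro mult_left_mono) auto
  with K have K32: "K \<ge> 32" by simp
  define ok where "ok = (\<lambda>j. N / 2 ^ j \<le> K / 32)"
  \<comment> \<open>At level \<open>J\<close> the expected sample size is at most 1, so
    \<open>K >= 32\<close> suffices.\<close>
  have okJ: "ok J"
  proof -
    have "N \<le> 2 ^ J" unfolding N_def using J by (metis of_nat_le_iff of_nat_numeral of_nat_power)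
    then have "N / 2 ^ J \<le> 1" by simp
    then show ?thesis unfolding ok_def using K32 by linarith
  qed
  define j0 where "j0 = (LEAST j. ok j)"
  have ok0: "ok j0" unfolding j0_def by (rule LeastI[of ok J, OF okJ])
  have j0J: "j0 \<le> J" unfolding j0_def by (rule Least_le[of ok J, OF okJ])
  obtain D where D: "\<And>B E j. E \<in> F \<Longrightarrow> j \<le> j0 \<Longrightarrow> \<bar>real (card E) - 2 ^ j * real (card (E \<inter> samp B j A))\<bar> \<le> D B"
    "\<And>B. 0 \<le> D B"
    "measure_pmf.expectation (coins J U) D \<le> 48 * sqrt (real \<nu> * real (card A)) * (\<Sum>i<j0. sqrt 2 ^ i)"
    using samp_deviation[OF U A F VC \<nu> j0J] by blast
  have int: "integrable (measure_pmf (coins J U)) f" for f :: "_ \<Rightarrow> real"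
    by (rule integrable_measure_pmf_finite[OF finite_set_coins[OF U]])
  have eD: "measure_pmf.expectation (coins J U) D \<le> \<epsilon> * N / 64"
  proof (cases j0)
    case 0
    then have "measure_pmf.expectation (coins J U) D \<le> 0" using D(3) by simp
    moreover have "0 \<le> \<epsilon> * N / 64" using \<epsilon> N0 by simp
    ultimately show ?thesis by linarith
  next
    \<comment> \<open>Level \<open>i\<close> fails \<open>ok\<close>, which gives
      \<open>2 ^ j0 * K <= 64 * N\<close>: 32 from \<open>ok\<close> and 2 from the step to
      \<open>Suc i\<close>. Below, \<open>9216 = 73728 / 8 = 64 * 144\<close>.\<close>
    case (Suc i)
    then have "\<not> ok i" unfolding j0_def by (metis lessI not_less_Least)
    then have "K / 32 < N / 2 ^ i" by (simp add: ok_def)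
    then have jK: "2 ^ j0 * K \<le> 64 * N" using Suc by (simp add: field_simps)
    have "2 ^ j0 * (73728\<^sup>2 * (real \<nu> / \<epsilon>\<^sup>2)) \<le> 2 ^ j0 * K" using K by (intro mult_left_mono) auto
    with jK have le: "2 ^ j0 * (73728\<^sup>2 * (real \<nu> / \<epsilon>\<^sup>2)) \<le> 64 * N" by linarith
    have "real \<nu> * N * 2 ^ j0 = (2 ^ j0 * (73728\<^sup>2 * (real \<nu> / \<epsilon>\<^sup>2))) * (N * (\<epsilon>\<^sup>2 / 73728\<^sup>2))"
      using \<epsilon> by simp
    also have "\<dots> \<le> (64 * N) * (N * (\<epsilon>\<^sup>2 / 73728\<^sup>2))"
      using le N0 by (intro mult_right_mono) auto
    also have "\<dots> = (\<epsilon> * N / 9216)\<^sup>2" by (simp add: power2_eq_square)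
    finally have "sqrt (real \<nu> * N * 2 ^ j0) \<le> \<epsilon> * N / 9216"
      using \<epsilon> N0 by (intro real_le_lsqrt) auto
    moreover have "48 * sqrt (real \<nu> * N) * (\<Sum>i<j0. sqrt 2 ^ i) \<le> 48 * sqrt (real \<nu> * N) * (3 * sqrt 2 ^ j0)"
      using N0 by (intro mult_left_mono sum_sqrt2_le) auto
    moreover have "48 * sqrt (real \<nu> * N) * (3 * sqrt 2 ^ j0) = 144 * sqrt (real \<nu> * N * 2 ^ j0)"
      by (simp add: real_sqrt_mult real_sqrt_power)
    ultimately show ?thesis using D(3) unfolding N_def by linarith
  qed
  have p1: "measure_pmf.prob (coins J U) {B. D B \<ge> \<epsilon> * N / 2} \<le> 1/32"
  proof -
    have "measure_pmf.prob (coins J U) {B \<in> space (measure_pmf (coins J U)). D B \<ge> \<epsilon> * N / 2}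
        \<le> measure_pmf.expectation (coins J U) D / (\<epsilon> * N / 2)"
      by (rule integral_Markov_inequality_measure[OF int]) (use D(2) \<epsilon> N0 in auto)
    also have "\<dots> \<le> (\<epsilon> * N / 64) / (\<epsilon> * N / 2)"
      using eD \<epsilon> N0 by (intro divide_right_mono) auto
    also have "\<dots> = 1/32" using \<epsilon> N0 by simp
    finally show ?thesis by simp
  qed
  have p2: "measure_pmf.prob (coins J U) {B. real (card (samp B j0 A)) \<ge> K} \<le> 1/32"
  proof -
    have "measure_pmf.prob (coins J U) {B \<in> space (measure_pmf (coins J U)). real (card (samp B j0 A)) \<ge> K}
        \<le> measure_pmf.expectation (coins J U) (\<lambda>B. real (card (samp B j0 A))) / K"
      by (rule integral_Markov_inequality_measure[OF int]) (use K32 in auto)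
    also have "\<dots> \<le> (K / 32) / K"
      using ok0 K32 expectation_card_samp[OF U A(1) j0J] by (intro divide_right_mono) (auto simp: ok_def N_def)
    also have "\<dots> = 1/32" using K32 by simp
    finally show ?thesis by simp
  qed
  have sub: "UNIV - good_coins K \<epsilon> J A F \<subseteq> {B. D B \<ge> \<epsilon> * N / 2} \<union> {B. real (card (samp B j0 A)) \<ge> K}"
  proof
    fix B assume B: "B \<in> UNIV - good_coins K \<epsilon> J A F"
    show "B \<in> {B. D B \<ge> \<epsilon> * N / 2} \<union> {B. real (card (samp B j0 A)) \<ge> K}"
    proof (rule ccontr)
      assume "\<not> ?thesis"
      then have "D B < \<epsilon> * N / 2" and c: "real (card (samp B j0 A)) < K" by auto
      then have "\<forall>E\<in>F. \<forall>j\<le>j0. \<bar>real (card E) - 2 ^ j * real (card (E \<inter> samp B j A))\<bar> \<le> \<epsilon> * real (card A) / 2"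
        using D(1)[of _ _ B] unfolding N_def by (meson less_imp_le order_trans)
      with c j0J have "B \<in> good_coins K \<epsilon> J A F" unfolding good_coins_def by blast
      with B show False by blast
    qed
  qed
  have "measure_pmf.prob (coins J U) (UNIV - good_coins K \<epsilon> J A F) \<le>
      measure_pmf.prob (coins J U) ({B. D B \<ge> \<epsilon> * N / 2} \<union> {B. real (card (samp B j0 A)) \<ge> K})"
    by (rule measure_pmf.finite_measure_mono[OF sub]) simp
  also have "\<dots> \<le> 1/32 + 1/32"
    using p1 p2 by (intro order_trans[OF measure_Un_le] add_mono) auto
  finally have "measure_pmf.prob (coins J U) (UNIV - good_coins K \<epsilon> J A F) \<le> 1/16" by simp
  then show ?thesis
    using measure_pmf.prob_compl[of "good_coins K \<epsilon> J A F" "coins J U"] by simp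
qed

section \<open>Truncated samples and medians\<close>

text \<open>An insertion can only push elements further back, so what once lies beyond position
  \<open>K\<close> never returns. This is why a truncated buffer can be maintained online.\<close>

lemma take_insort_key_take: "take K (insort_key f x (take K l)) = take K (insort_key f x l)"
proof (induction l arbitrary: K)
  case (Cons y l)
  then show ?case by (cases K) (auto simp: take_Cons' split: if_splits)
qed simp

text \<open>\<open>sort_key\<close> inserts from the right end of its argument, so after
  \<open>rev\<close> the newest item is inserted last, as in the stream. The negated key puts late
  expirations first.\<close>

definition stored :: "nat \<Rightarrow> item list \<Rightarrow> nat set \<Rightarrow> item list" where
  "stored K ys I = take K (sort_key (\<lambda>x. - exp_time x) (rev (nths ys I)))"

definition keep :: "nat \<Rightarrow> item \<Rightarrow> item list \<Rightarrow> item list" where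
  "keep K it l = take K (insort_key (\<lambda>x. - exp_time x) it l)"

lemma nths_cong_length: "(\<And>i. i < length ys \<Longrightarrow> i \<in> I \<longleftrightarrow> i \<in> I') \<Longrightarrow> nths ys I = nths ys I'"
  unfolding nths_def by (intro arg_cong[of _ _ "map fst"] filter_cong) (auto simp: set_zip)

lemma stored_snoc:
  assumes "\<And>i. i < length ys \<Longrightarrow> i \<in> I' \<longleftrightarrow> i \<in> I"
  shows "stored K (ys @ [it]) I' = (if length ys \<in> I' then keep K it (stored K ys I) else stored K ys I)"
proof -
  have "nths ys I' = nths ys I" by (rule nths_cong_length) (use assms in auto)
  then show ?thesis by (simp add: stored_def keep_def nths_append take_insort_key_take)
qed

lemma length_stored: "length (stored K ys I) \<le> K"
  by (simp add: stored_def)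

lemma set_stored: "set (stored K ys I) \<subseteq> set ys"
  by (auto simp: stored_def dest!: in_set_takeD in_set_nthsD)

text \<open>In order of decreasing \<open>f\<close> the elements with value above \<open>t\<close>
  form a prefix, and taking prefixes commutes.\<close>

lemma filter_take_sorted:
  fixes f :: "'a \<Rightarrow> real"
  assumes "sorted (map (\<lambda>x. - f x) g)"
  shows "filter (\<lambda>x. t < f x) (take K g) = take K (filter (\<lambda>x. t < f x) g)"
  using assms
proof (induction g arbitrary: K)
  case (Cons x g)
  show ?case
  proof (cases "t < f x")
    case True
    then show ?thesis using Cons by (cases K) auto
  next
    case False
    then have "\<forall>y\<in>set (x # g). \<not> t < f y" using Cons.prems by auto
    then have "filter (\<lambda>x. t < f x) (take K (x # g)) = []" "filter (\<lambda>x. t < f x) (x # g) = []"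
      unfolding filter_empty_conv by (meson in_set_takeD)+
    then show ?thesis by simp
  qed
qed simp

lemma length_filter_nths:
  "length (filter Q (nths ys I)) = card {i. i < length ys \<and> i \<in> I \<and> Q (ys ! i)}"
proof (induction ys rule: rev_induct)
  case (snoc y ys)
  let ?S = "{i. i < length ys \<and> i \<in> I \<and> Q (ys ! i)}"
  have "{i. i < length (ys @ [y]) \<and> i \<in> I \<and> Q ((ys @ [y]) ! i)} =
    ?S \<union> (if length ys \<in> I \<and> Q y then {length ys} else {})"
    by (auto simp: nth_append less_Suc_eq split: if_splits)
  moreover have "card (?S \<union> (if length ys \<in> I \<and> Q y then {length ys} else {})) =
    card ?S + (if length ys \<in> I \<and> Q y then 1 else 0)"
    by (subst card_Un_disjoint) auto
  ultimately show ?case using snoc by (simp add: nths_append)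
qed simp

lemma stored_active:
  fixes t :: real
  defines "act \<equiv> filter (\<lambda>x. t < exp_time x)"
  shows "length (act (stored K ys I)) = min K (card {i. i < length ys \<and> i \<in> I \<and> t < exp_time (ys ! i)})"
    and "length (act (stored K ys I)) < K \<Longrightarrow>
      length (filter P (act (stored K ys I))) = card {i. i < length ys \<and> i \<in> I \<and> t < exp_time (ys ! i) \<and> P (ys ! i)}"
proof -
  define g where "g = sort_key (\<lambda>x. - exp_time x) (rev (nths ys I))"
  have eq: "act (stored K ys I) = take K (act g)"
    unfolding act_def stored_def g_def by (rule filter_take_sorted) simp
  have mg: "mset g = mset (nths ys I)" by (simp add: g_def)
  have len: "length (filter Q g) = card {i. i < length ys \<and> i \<in> I \<and> Q (ys ! i)}" for Q
    using mg by (metis length_filter_nths mset_filter size_mset)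
  show l: "length (act (stored K ys I)) = min K (card {i. i < length ys \<and> i \<in> I \<and> t < exp_time (ys ! i)})"
    unfolding eq using len[of "\<lambda>x. t < exp_time x"] by (simp add: act_def)
  assume "length (act (stored K ys I)) < K"
  then have "take K (act g) = act g" unfolding eq by (simp add: min_def split: if_splits)
  then have "filter P (act (stored K ys I)) = filter (\<lambda>x. P x \<and> t < exp_time x) g"
    unfolding eq by (simp add: act_def conj_commute)
  then show "length (filter P (act (stored K ys I))) = card {i. i < length ys \<and> i \<in> I \<and> t < exp_time (ys ! i) \<and> P (ys ! i)}"
    using len[of "\<lambda>x. P x \<and> t < exp_time x"] by (simp add: conj_ac)
qed

section \<open>Tossing the coins one item at a time\<close>

text \<open>Serves twice: for the rounds within one copy and for the independent copies. The inner
  defaults \<open>d'\<close> and \<open>d''\<close> are arbitrary, as \<open>d\<close> overrides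
  them outside \<open>A\<close>.\<close>

lemma Pi_pmf_step:
  assumes A: "finite A"
  shows "Pi_pmf A d (\<lambda>_. do {x \<leftarrow> p; b \<leftarrow> q; return_pmf (g x b)}) =
    do {X \<leftarrow> Pi_pmf A d' (\<lambda>_. p); b \<leftarrow> Pi_pmf A d'' (\<lambda>_. q); return_pmf (\<lambda>k. if k \<in> A then g (X k) (b k) else d)}"
  by (subst Pi_pmf_bind[OF A, where d' = d'], subst Pi_pmf_bind[OF A, where d' = d''])
     (use A in simp)

definition bits :: "nat \<Rightarrow> (nat \<Rightarrow> bool) pmf" where
  "bits J = Pi_pmf {..<J} False (\<lambda>_. bernoulli_pmf (1/2))"

definition ext_coins :: "nat \<Rightarrow> nat \<Rightarrow> (nat \<Rightarrow> nat set) \<Rightarrow> (nat \<Rightarrow> bool) \<Rightarrow> nat \<Rightarrow> nat set" where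
  "ext_coins J m B b = (\<lambda>k. if k \<in> {..<J} then if b k then insert m (B k) else B k else {})"

text \<open>The analysis draws a whole subset of positions per round, whereas the sketch tosses bits
  when an item arrives and forgets them. A uniform subset of \<open>{..<Suc m}\<close> is one of
  \<open>{..<m}\<close> plus a fair decision about \<open>m\<close>, so both views agree and no
  coins have to be stored.\<close>

lemma coins_Suc:
  "coins J {..<Suc m} = do {B \<leftarrow> coins J {..<m}; b \<leftarrow> bits J; return_pmf (ext_coins J m B b)}"
proof -
  have "pmf_of_set (Pow {..<Suc m}) =
      map_pmf (\<lambda>f. {x \<in> {..<Suc m}. f x}) (Pi_pmf {..<Suc m} False (\<lambda>_. bernoulli_pmf (1/2)))"
    by (rule pmf_of_set_Pow_conv_bernoulli[symmetric]) simp
  also have "\<dots> = do {y \<leftarrow> bernoulli_pmf (1/2); f \<leftarrow> Pi_pmf {..<m} False (\<lambda>_. bernoulli_pmf (1/2));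
      return_pmf (if y then insert m {x \<in> {..<m}. f x} else {x \<in> {..<m}. f x})}"
  proof -
    have "{x \<in> {..<Suc m}. (f(m := y)) x} = (if y then insert m {x \<in> {..<m}. f x} else {x \<in> {..<m}. f x})" for f y
      by (auto simp: less_Suc_eq)
    then show ?thesis
      unfolding lessThan_Suc by (subst Pi_pmf_insert') (simp_all add: map_bind_pmf)
  qed
  also have "\<dots> = do {f \<leftarrow> Pi_pmf {..<m} False (\<lambda>_. bernoulli_pmf (1/2)); y \<leftarrow> bernoulli_pmf (1/2);
      return_pmf (if y then insert m {x \<in> {..<m}. f x} else {x \<in> {..<m}. f x})}"
    by (rule bind_commute_pmf)
  also have "\<dots> = do {X \<leftarrow> map_pmf (\<lambda>f. {x \<in> {..<m}. f x}) (Pi_pmf {..<m} False (\<lambda>_. bernoulli_pmf (1/2)));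
      y \<leftarrow> bernoulli_pmf (1/2); return_pmf (if y then insert m X else X)}"
    by (simp only: bind_map_pmf)
  also have "map_pmf (\<lambda>f. {x \<in> {..<m}. f x}) (Pi_pmf {..<m} False (\<lambda>_. bernoulli_pmf (1/2))) = pmf_of_set (Pow {..<m})"
    by (rule pmf_of_set_Pow_conv_bernoulli) simp
  finally have "pmf_of_set (Pow {..<Suc m}) =
    do {X \<leftarrow> pmf_of_set (Pow {..<m}); y \<leftarrow> bernoulli_pmf (1/2); return_pmf (if y then insert m X else X)}" .
  then show ?thesis
    unfolding coins_def bits_def ext_coins_def
    by (simp only:) (rule Pi_pmf_step, simp)
qed

text \<open>
  The median is a natural number, so that a range minimizing it exists even if there are infinitely
  many ranges.
\<close>

definition med :: "nat \<Rightarrow> (nat \<Rightarrow> nat) \<Rightarrow> nat" where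
  "med L e = (LEAST v. L \<le> 2 * card {c. c < L \<and> e c \<le> v})"

text \<open>The largest good value has a majority at or below it, so the median does not exceed it.
  A median below \<open>lo\<close> would have at least half of the entries at or below it, all of
  them bad.\<close>

lemma med_bounds:
  fixes lo hi :: real
  assumes bad: "2 * card {c. c < L \<and> \<not> (lo \<le> real (e c) \<and> real (e c) \<le> hi)} < L"
  shows "lo \<le> real (med L e)" "real (med L e) \<le> hi"
proof -
  let ?bad = "{c. c < L \<and> \<not> (lo \<le> real (e c) \<and> real (e c) \<le> hi)}"
  define good where "good = {c. c < L \<and> lo \<le> real (e c) \<and> real (e c) \<le> hi}"
  have fin: "finite good" by (simp add: good_def)
  have "good \<union> ?bad = {..<L}" "good \<inter> ?bad = {}" by (auto simp: good_def)
  then have sum: "card good + card ?bad = L"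
    by (metis (no_types, lifting) card_Un_disjoint card_lessThan finite_Un finite_lessThan)
  with bad have "card good > 0" by linarith
  then have ne: "good \<noteq> {}" by auto
  define v where "v = Max (e ` good)"
  have "v \<in> e ` good" unfolding v_def using fin ne by (intro Max_in) auto
  then have vhi: "real v \<le> hi" by (auto simp: good_def)
  have "good \<subseteq> {c. c < L \<and> e c \<le> v}" unfolding v_def using fin by (auto simp: good_def)
  then have "card good \<le> card {c. c < L \<and> e c \<le> v}" by (intro card_mono) auto
  then have Pv: "L \<le> 2 * card {c. c < L \<and> e c \<le> v}" using sum bad by linarith
  have "med L e \<le> v" unfolding med_def by (rule Least_le[of "\<lambda>v. L \<le> 2 * card {c. c < L \<and> e c \<le> v}", OF Pv])
  with vhi show "real (med L e) \<le> hi" by linarith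
  have Pm: "L \<le> 2 * card {c. c < L \<and> e c \<le> med L e}" unfolding med_def by (rule LeastI[of "\<lambda>v. L \<le> 2 * card {c. c < L \<and> e c \<le> v}", OF Pv])
  show "lo \<le> real (med L e)"
  proof (rule ccontr)
    assume "\<not> ?thesis"
    then have "{c. c < L \<and> e c \<le> med L e} \<subseteq> ?bad" by auto
    then have "card {c. c < L \<and> e c \<le> med L e} \<le> card ?bad" by (intro card_mono) auto
    with Pm bad show False by linarith
  qed
qed

text \<open>Exponential Markov inequality with weight 16 per bad copy. The expected weight of a copy
  is at most \<open>1 + 15/16 <= 2\<close>, a bad half gives product at least
  \<open>16 ^ (L / 2) = 4 ^ L\<close>, and the quotient is \<open>(2 / 4) ^ L\<close>.\<close>

lemma prob_majority:
  assumes G: "measure_pmf.prob p G \<ge> 15/16" and fin: "finite (set_pmf p)"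
  shows "measure_pmf.prob (Pi_pmf {..<L} d (\<lambda>_. p)) {X. 2 * card {c. c < L \<and> X c \<notin> G} < L} \<ge> 1 - (1/2) ^ L"
proof -
  define u where "u = (\<lambda>x. if x \<in> G then 1 else 16 :: real)"
  let ?P = "Pi_pmf {..<L} d (\<lambda>_. p)"
  have finP: "finite (set_pmf ?P)"
    by (rule finite_subset[OF set_Pi_pmf_subset']) (auto intro!: finite_PiE_dflt fin)
  have int: "integrable (measure_pmf q) f" if "finite (set_pmf q)" for q :: "'z pmf" and f :: "'z \<Rightarrow> real"
    by (rule integrable_measure_pmf_finite[OF that])
  have eu: "measure_pmf.expectation p u \<le> 31/16"
  proof -
    have "u = (\<lambda>x. 16 - 15 * indicator G x)" by (auto simp: u_def)
    then have "measure_pmf.expectation p u = 16 - 15 * measure_pmf.prob p G"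
      by (simp add: int[OF fin])
    then show ?thesis using G by linarith
  qed
  have prod: "(\<Prod>c<L. u (X c)) = 16 ^ card {c. c < L \<and> X c \<notin> G}" for X
  proof -
    have "(\<Prod>c<L. u (X c)) = (\<Prod>c\<in>{..<L} \<inter> {c. X c \<notin> G}. 16)"
      unfolding u_def by (subst prod.inter_restrict) (auto intro!: prod.cong)
    also have "{..<L} \<inter> {c. X c \<notin> G} = {c. c < L \<and> X c \<notin> G}" by auto
    finally show ?thesis by simp
  qed
  have "measure_pmf.prob ?P {X \<in> space (measure_pmf ?P). (\<Prod>c<L. u (X c)) \<ge> 4 ^ L} \<le>
      measure_pmf.expectation ?P (\<lambda>X. \<Prod>c<L. u (X c)) / 4 ^ L"
    by (rule integral_Markov_inequality_measure[OF int[OF finP]]) (auto simp: u_def intro!: prod_nonneg)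
  also have "measure_pmf.expectation ?P (\<lambda>X. \<Prod>c<L. u (X c)) = (\<Prod>c<L. measure_pmf.expectation p u)"
    by (rule expectation_prod_Pi_pmf) (auto simp: u_def int[OF fin])
  also have "\<dots> = measure_pmf.expectation p u ^ L" by simp
  also have "measure_pmf.expectation p u ^ L / 4 ^ L \<le> 2 ^ L / 4 ^ L"
  proof (intro divide_right_mono power_mono)
    show "0 \<le> measure_pmf.expectation p u" by (rule integral_nonneg_AE) (auto simp: u_def)
  qed (use eu in auto)
  also have "(2::real) ^ L / 4 ^ L = (1/2) ^ L" by (simp flip: power_divide)
  finally have m: "measure_pmf.prob ?P {X. (\<Prod>c<L. u (X c)) \<ge> 4 ^ L} \<le> (1/2) ^ L" by simp
  have sub: "UNIV - {X. 2 * card {c. c < L \<and> X c \<notin> G} < L} \<subseteq> {X. (\<Prod>c<L. u (X c)) \<ge> 4 ^ L}"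
  proof
    fix X assume "X \<in> UNIV - {X. 2 * card {c. c < L \<and> X c \<notin> G} < L}"
    then have "L \<le> 2 * card {c. c < L \<and> X c \<notin> G}" by auto
    then have "(4::real) ^ L \<le> 4 ^ (2 * card {c. c < L \<and> X c \<notin> G})" by (intro power_increasing) auto
    then show "X \<in> {X. (\<Prod>c<L. u (X c)) \<ge> 4 ^ L}" by (simp add: prod power_mult)
  qed
  have "measure_pmf.prob ?P (UNIV - {X. 2 * card {c. c < L \<and> X c \<notin> G} < L}) \<le> (1/2) ^ L"
    using measure_pmf.finite_measure_mono[OF sub, of ?P] m by auto
  then show ?thesis
    using measure_pmf.prob_compl[of "{X. 2 * card {c. c < L \<and> X c \<notin> G} < L}" ?P] by simp
qed

section \<open>The sketch\<close>

locale level_sketch =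
  fixes d K J L :: nat and \<R> :: "point set set"
begin

definition item_words :: "item \<Rightarrow> real list" where
  "item_words it = pt it @ [of_int (label it), ins_time it, exp_time it]"

text \<open>
  Memory has a fixed length, and the label \<open>0\<close> marks an empty slot.  Hence no counters are stored and
  the integer words \<open>-1, 0, 1\<close> suffice.
\<close>

definition slot :: "item list \<Rightarrow> nat \<Rightarrow> real list" where
  "slot l k = (if k < length l then item_words (l ! k) else replicate (d + 3) 0)"

definition slots :: "(nat \<times> nat \<times> nat) list" where
  "slots = List.product [0..<L] (List.product [0..<Suc J] [0..<K])"

definition encode :: "(nat \<Rightarrow> nat \<Rightarrow> item list) \<Rightarrow> memory" where
  "encode st = concat (map (\<lambda>(c, j, k). slot (st c j) k) slots)"

definition proper_item :: "item \<Rightarrow> bool" where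
  "proper_item it \<longleftrightarrow> length (pt it) = d \<and> label it \<in> {-1, 1}"

text \<open>Outside the index range the state is pinned to \<open>[]\<close>, because the memory
  records nothing there.\<close>

definition proper :: "(nat \<Rightarrow> nat \<Rightarrow> item list) \<Rightarrow> bool" where
  "proper st \<longleftrightarrow> (\<forall>c j. length (st c j) \<le> K \<and> (\<forall>it\<in>set (st c j). proper_item it) \<and>
     (\<not> (c < L \<and> j \<le> J) \<longrightarrow> st c j = []))"

text \<open>Only space is charged, so decoding may be an abstract inverse; injectivity of
  \<open>encode\<close> on proper states is all that has to be shown.\<close>

definition decode :: "memory \<Rightarrow> nat \<Rightarrow> nat \<Rightarrow> item list" where
  "decode = inv_into {st. proper st} encode"

section \<open>Recovering the state from the memory\<close>

lemma length_slot: "\<forall>it\<in>set l. proper_item it \<Longrightarrow> length (slot l k) = d + 3"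
  by (auto simp: slot_def item_words_def proper_item_def)

lemma slot_nth_label:
  "\<forall>it\<in>set l. proper_item it \<Longrightarrow> slot l k ! d = (if k < length l then of_int (label (l ! k)) else 0)"
  by (auto simp: slot_def item_words_def proper_item_def nth_append dest!: nth_mem)

lemma item_words_inject:
  "proper_item x \<Longrightarrow> proper_item y \<Longrightarrow> item_words x = item_words y \<Longrightarrow> x = y"
  by (cases x; cases y) (auto simp: item_words_def proper_item_def)

lemma slot_inject:
  assumes l: "\<forall>it\<in>set l. proper_item it" "length l \<le> K" and l': "\<forall>it\<in>set l'. proper_item it" "length l' \<le> K"
    and eq: "\<And>k. k < K \<Longrightarrow> slot l k = slot l' k"
  shows "l = l'"
proof -
  \<comment> \<open>Position \<open>d\<close> of a slot holds the label, which is nonzero exactly in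
    filled slots.\<close>
  have lab: "k < length l \<longleftrightarrow> k < length l'" if "k < K" for k
  proof -
    have "label it \<noteq> 0" if "it \<in> set l \<union> set l'" for it
      using l l' that by (auto simp: proper_item_def)
    then have "slot l k ! d \<noteq> 0 \<longleftrightarrow> k < length l" "slot l' k ! d \<noteq> 0 \<longleftrightarrow> k < length l'"
      using slot_nth_label[OF l(1), of k] slot_nth_label[OF l'(1), of k] nth_mem[of k l] nth_mem[of k l'] by auto
    then show ?thesis using eq[OF that] by simp
  qed
  have len: "length l = length l'"
    \<comment> \<open>The first empty slot reveals the length; a list of length \<open>K\<close> has
      none, and there the bounds by \<open>K\<close> decide.\<close>
    using lab[of "length l"] lab[of "length l'"] l(2) l'(2) by arith
  show ?thesis
  proof (rule nth_equalityI[OF len])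
    fix k assume k: "k < length l"
    then have "item_words (l ! k) = item_words (l' ! k)" using eq[of k] l(2) len by (simp add: slot_def)
    then show "l ! k = l' ! k" using k l(1) l'(1) len by (intro item_words_inject) auto
  qed
qed

text \<open>All slots have length \<open>d + 3\<close>, so the concatenation can be cut back into
  slots without separators.\<close>

lemma inj_on_encode: "inj_on encode {st. proper st}"
proof (rule inj_onI)
  fix st st' assume "st \<in> {st. proper st}" "st' \<in> {st. proper st}" and eq: "encode st = encode st'"
  then have p: "proper st" "proper st'" by auto
  have items: "\<forall>it\<in>set (st c j). proper_item it" "\<forall>it\<in>set (st' c j). proper_item it"
    "length (st c j) \<le> K" "length (st' c j) \<le> K" for c j
    using p by (auto simp: proper_def)
  have "map (\<lambda>(c, j, k). slot (st c j) k) slots = map (\<lambda>(c, j, k). slot (st' c j) k) slots"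
  proof (rule concat_injective[OF eq[unfolded encode_def]])
    show "\<forall>(x, y)\<in>set (zip (map (\<lambda>(c, j, k). slot (st c j) k) slots) (map (\<lambda>(c, j, k). slot (st' c j) k) slots)).
        length x = length y"
      by (auto simp: set_zip length_slot[OF items(1)] length_slot[OF items(2)] split: prod.splits)
  qed simp
  then have eq': "\<forall>(c, j, k)\<in>set slots. slot (st c j) k = slot (st' c j) k" by auto
  have sl: "slot (st c j) k = slot (st' c j) k" if "c < L" "j \<le> J" "k < K" for c j k
  proof -
    have "(c, j, k) \<in> set slots" using that by (auto simp: slots_def)
    then show ?thesis using eq' by fastforce
  qed
  show "st = st'"
  proof (intro ext)
    fix c j
    show "st c j = st' c j"
    proof (cases "c < L \<and> j \<le> J")
      case True
      then show ?thesis by (intro slot_inject items sl) auto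
    next
      case False
      then show ?thesis using p by (simp add: proper_def)
    qed
  qed
qed

lemma decode_encode: "proper st \<Longrightarrow> decode (encode st) = st"
  unfolding decode_def by (rule inv_into_f_f[OF inj_on_encode]) simp

lemma length_encode: "proper st \<Longrightarrow> length (encode st) = L * (Suc J * K) * (d + 3)"
proof -
  assume p: "proper st"
  have "length (encode st) = sum_list (map (\<lambda>(c, j, k). length (slot (st c j) k)) slots)"
    unfolding encode_def length_concat map_map by (rule arg_cong[of _ _ sum_list]) auto
  also have "map (\<lambda>(c, j, k). length (slot (st c j) k)) slots = map (\<lambda>_. d + 3) slots"
    using p by (intro map_cong) (auto simp: proper_def length_slot)
  finally show ?thesis by (simp add: slots_def sum_list_triv length_product)
qed

lemma set_encode:
  assumes "proper st" "\<And>c j. set (st c j) \<subseteq> X"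
  shows "set (encode st) \<subseteq> (\<Union>it\<in>X. set (pt it) \<union> {ins_time it, exp_time it}) \<union> {-1, 0, 1}"
proof
  fix x assume "x \<in> set (encode st)"
  then obtain c j k where x: "x \<in> set (slot (st c j) k)" by (auto simp: encode_def)
  show "x \<in> (\<Union>it\<in>X. set (pt it) \<union> {ins_time it, exp_time it}) \<union> {-1, 0, 1}"
  proof (cases "k < length (st c j)")
    case True
    define it where "it = st c j ! k"
    have "it \<in> set (st c j)" using True by (simp add: it_def)
    then have "it \<in> X" "label it \<in> {-1, 1}"
      using assms(2)[of c j] assms(1) by (blast, auto simp: proper_def proper_item_def)
    moreover have "x \<in> set (pt it) \<union> {of_int (label it), ins_time it, exp_time it}"
      using x True by (simp add: slot_def item_words_def it_def)
    ultimately show ?thesis by auto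
  next
    case False
    then show ?thesis using x by (simp add: slot_def split: if_splits)
  qed
qed

section \<open>The state as a function of the coins\<close>

definition copy_state :: "item list \<Rightarrow> (nat \<Rightarrow> nat set) \<Rightarrow> nat \<Rightarrow> item list" where
  "copy_state ys B = (\<lambda>j. if j \<le> J then stored K ys (samp B j {..<length ys}) else [])"

definition copy_update :: "item \<Rightarrow> (nat \<Rightarrow> bool) \<Rightarrow> (nat \<Rightarrow> item list) \<Rightarrow> nat \<Rightarrow> item list" where
  "copy_update it b l = (\<lambda>j. if j \<le> J \<and> (\<forall>k<j. b k) then keep K it (l j) else l j)"

lemma copy_state_snoc:
  assumes B: "\<And>k. B k \<subseteq> {..<length ys}"
  shows "copy_state (ys @ [it]) (ext_coins J (length ys) B b) = copy_update it b (copy_state ys B)"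
proof
  fix j
  let ?m = "length ys" let ?B = "ext_coins J (length ys) B b"
  show "copy_state (ys @ [it]) ?B j = copy_update it b (copy_state ys B) j"
  proof (cases "j \<le> J")
    case True
    have old: "i \<in> samp ?B j {..<Suc ?m} \<longleftrightarrow> i \<in> samp B j {..<?m}" if "i < ?m" for i
      using that True by (auto simp: samp_def ext_coins_def)
    \<comment> \<open>Each \<open>B k\<close> contains only old positions, so \<open>?m\<close>
      belongs to round \<open>k\<close> exactly if its fresh bit is set.\<close>
    have new: "?m \<in> samp ?B j {..<Suc ?m} \<longleftrightarrow> (\<forall>k<j. b k)"
    proof -
      have "?m \<in> ?B k \<longleftrightarrow> b k" if "k < j" for k
        using that True B[of k] by (auto simp: ext_coins_def)
      then show ?thesis by (auto simp: samp_def)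
    qed
    have "stored K (ys @ [it]) (samp ?B j {..<Suc ?m}) = (if ?m \<in> samp ?B j {..<Suc ?m}
        then keep K it (stored K ys (samp B j {..<?m})) else stored K ys (samp B j {..<?m}))"
      by (rule stored_snoc[OF old])
    then show ?thesis
      unfolding copy_state_def copy_update_def length_append_singleton
      by (simp only: new True if_True simp_thms)
  next
    case False
    then show ?thesis by (simp add: copy_state_def copy_update_def)
  qed
qed

definition all_state :: "item list \<Rightarrow> (nat \<Rightarrow> nat \<Rightarrow> nat set) \<Rightarrow> nat \<Rightarrow> nat \<Rightarrow> item list" where
  "all_state ys Bs = (\<lambda>c. if c < L then copy_state ys (Bs c) else (\<lambda>_. []))"

definition all_coins :: "nat \<Rightarrow> (nat \<Rightarrow> nat \<Rightarrow> nat set) pmf" where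
  "all_coins m = Pi_pmf {..<L} (\<lambda>_. {}) (\<lambda>_. coins J {..<m})"

definition all_bits :: "(nat \<Rightarrow> nat \<Rightarrow> bool) pmf" where
  "all_bits = Pi_pmf {..<L} (\<lambda>_. False) (\<lambda>_. bits J)"

definition sketch_update :: "item \<Rightarrow> memory \<Rightarrow> memory pmf" where
  "sketch_update it s = map_pmf (\<lambda>b. encode (\<lambda>c. if c < L then copy_update it (b c) (decode s c) else (\<lambda>_. []))) all_bits"

definition active_part :: "real \<Rightarrow> item list \<Rightarrow> item list" where
  "active_part t = filter (\<lambda>x. t < exp_time x)"

text \<open>Unspecified if every level has at least \<open>K\<close> active items;
  \<open>good_coins\<close> excludes that case.\<close>

definition level :: "real \<Rightarrow> (nat \<Rightarrow> item list) \<Rightarrow> nat" where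
  "level t l = (LEAST j. length (active_part t (l j)) < K)"

definition estimate :: "real \<Rightarrow> (nat \<Rightarrow> item list) \<Rightarrow> point set \<Rightarrow> nat" where
  "estimate t l R = 2 ^ level t l *
     length (filter (\<lambda>it. range_fun R (pt it) \<noteq> label it) (active_part t (l (level t l))))"

definition answer :: "(nat \<Rightarrow> nat \<Rightarrow> item list) \<Rightarrow> real \<Rightarrow> point \<Rightarrow> int" where
  "answer st t = range_fun (ARG_MIN (\<lambda>R. med L (\<lambda>c. estimate t (st c) R)) R. R \<in> \<R>)"

definition the_sketch :: sketch where
  "the_sketch = Sketch (return_pmf (encode (\<lambda>_ _. []))) sketch_update (\<lambda>s. answer (decode s))"

lemma proper_all_state:
  assumes "\<And>it. it \<in> set ys \<Longrightarrow> proper_item it"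
  shows "proper (all_state ys Bs)"
  unfolding proper_def all_state_def copy_state_def
  using assms length_stored[of K ys] set_stored[of K ys] by (auto simp: subset_iff)

lemma set_all_state: "set (all_state ys Bs c j) \<subseteq> set ys"
  using set_stored[of K ys] by (auto simp: all_state_def copy_state_def subset_iff)

lemma all_coins_Suc:
  "all_coins (Suc m) = do {Bs \<leftarrow> all_coins m; b \<leftarrow> all_bits;
     return_pmf (\<lambda>c. if c \<in> {..<L} then ext_coins J m (Bs c) (b c) else (\<lambda>_. {}))}"
  unfolding all_coins_def all_bits_def coins_Suc by (rule Pi_pmf_step) simp

lemma coins_subset: "B \<in> set_pmf (coins J U) \<Longrightarrow> finite U \<Longrightarrow> B k \<subseteq> U"
  unfolding coins_def using set_Pi_pmf_subset'[of "{..<J}" "{}" "\<lambda>_. pmf_of_set (Pow U)"]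
  by (cases "k < J") (auto simp: PiE_dflt_def set_pmf_of_set Pow_not_empty)

lemma all_coins_subset: "Bs \<in> set_pmf (all_coins m) \<Longrightarrow> Bs c k \<subseteq> {..<m}"
  unfolding all_coins_def using set_Pi_pmf_subset'[of "{..<L}" "\<lambda>_. {}" "\<lambda>_. coins J {..<m}"] coins_subset[where U = "{..<m}" and k = k]
  by (cases "c < L") (auto simp: PiE_dflt_def)

text \<open>Moves all randomness to the front: the memory has the law of a deterministic function of
  the stream and of coins drawn in advance, so the sampling bounds apply.\<close>

lemma run_the_sketch:
  assumes "\<And>it. it \<in> set ys \<Longrightarrow> proper_item it"
  shows "run the_sketch ys = map_pmf (\<lambda>Bs. encode (all_state ys Bs)) (all_coins (length ys))"
  using assms
proof (induction ys rule: rev_induct)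
  case Nil
  have "all_state [] Bs = (\<lambda>_ _. [])" for Bs
    by (auto simp: all_state_def copy_state_def stored_def fun_eq_iff)
  then show ?case by (simp add: run_def the_sketch_def map_pmf_const)
next
  case (snoc it ys)
  have "run the_sketch (ys @ [it]) = bind_pmf (run the_sketch ys) (sketch_update it)"
    by (simp add: run_def the_sketch_def)
  also have "run the_sketch ys = map_pmf (\<lambda>Bs. encode (all_state ys Bs)) (all_coins (length ys))"
    using snoc by simp
  also have "bind_pmf \<dots> (sketch_update it) =
    do {Bs \<leftarrow> all_coins (length ys); sketch_update it (encode (all_state ys Bs))}"
    by (simp add: bind_map_pmf)
  also have "\<dots> = do {Bs \<leftarrow> all_coins (length ys); b \<leftarrow> all_bits;
      return_pmf (encode (all_state (ys @ [it]) (\<lambda>c. if c \<in> {..<L} then ext_coins J (length ys) (Bs c) (b c) else (\<lambda>_. {}))))}"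
  proof (intro bind_pmf_cong refl)
    \<comment> \<open>Membership in the support ensures that the coin sets contain old positions
      only, as \<open>copy_state_snoc\<close> requires.\<close>
    fix Bs assume Bs: "Bs \<in> set_pmf (all_coins (length ys))"
    have "(\<lambda>c. if c < L then copy_update it (b c) (all_state ys Bs c) else (\<lambda>_. [])) =
      all_state (ys @ [it]) (\<lambda>c. if c \<in> {..<L} then ext_coins J (length ys) (Bs c) (b c) else (\<lambda>_. {}))" for b
      using copy_state_snoc[OF all_coins_subset[OF Bs]] by (auto simp: all_state_def fun_eq_iff)
    moreover have "decode (encode (all_state ys Bs)) = all_state ys Bs"
      by (rule decode_encode[OF proper_all_state]) (use snoc.prems in auto)
    ultimately show "sketch_update it (encode (all_state ys Bs)) = do {b \<leftarrow> all_bits;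
      return_pmf (encode (all_state (ys @ [it]) (\<lambda>c. if c \<in> {..<L} then ext_coins J (length ys) (Bs c) (b c) else (\<lambda>_. {}))))}"
      unfolding sketch_update_def map_pmf_def by (simp only:)
  qed
  also have "\<dots> = map_pmf (\<lambda>Bs. encode (all_state (ys @ [it]) Bs)) (all_coins (Suc (length ys)))"
    by (simp add: all_coins_Suc map_bind_pmf)
  finally show ?case by simp
qed

text \<open>Positions instead of points, so that repeated points and points with conflicting labels
  are counted separately.\<close>

definition error_set :: "item list \<Rightarrow> real \<Rightarrow> point set \<Rightarrow> nat set" where
  "error_set ys t R = {i \<in> active ys t. range_fun R (pt (ys ! i)) \<noteq> label (ys ! i)}"

text \<open>At the level \<open>j0\<close> of \<open>good_coins\<close> fewer than \<open>K\<close>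
  sampled items are active, so the level chosen by the query is at most \<open>j0\<close>. There the
  stored count is exact and the deviation bound applies.\<close>

lemma estimate_close:
  fixes \<epsilon> :: real
  assumes t: "\<And>it. it \<in> set ys \<Longrightarrow> ins_time it \<le> t" and R: "R \<in> \<R>"
    and B: "B \<in> good_coins (real K) \<epsilon> J (active ys t) (error_set ys t ` \<R>)"
  shows "\<bar>real (card (error_set ys t R)) - real (estimate t (copy_state ys B) R)\<bar> \<le> \<epsilon> * real (card (active ys t)) / 2"
proof -
  let ?A = "active ys t"
  \<comment> \<open>No insertion lies after \<open>t\<close>, so activity reduces to expiration, the
    key by which the lists are sorted.\<close>
  have A: "?A = {i. i < length ys \<and> t < exp_time (ys ! i)}"
    using t by (auto simp: active_def)
  obtain j0 where j0: "j0 \<le> J" "card (samp B j0 ?A) < K"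
    "\<And>E j. E \<in> error_set ys t ` \<R> \<Longrightarrow> j \<le> j0 \<Longrightarrow>
      \<bar>real (card E) - 2 ^ j * real (card (E \<inter> samp B j ?A))\<bar> \<le> \<epsilon> * real (card ?A) / 2"
    using B by (auto simp: good_coins_def)
  have set1: "{i. i < length ys \<and> i \<in> samp B j {..<length ys} \<and> t < exp_time (ys ! i)} = samp B j ?A" for j
    unfolding A by (auto simp: samp_def)
  have set2: "{i. i < length ys \<and> i \<in> samp B j {..<length ys} \<and> t < exp_time (ys ! i) \<and> range_fun R (pt (ys ! i)) \<noteq> label (ys ! i)} =
      error_set ys t R \<inter> samp B j ?A" for j
    unfolding error_set_def A by (auto simp: samp_def)
  let ?l = "copy_state ys B"
  have "length (active_part t (?l j0)) < K"
    using j0 stored_active(1)[of t K ys "samp B j0 {..<length ys}"]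
    by (simp add: copy_state_def active_part_def set1)
  then have lev: "level t ?l \<le> j0" "length (active_part t (?l (level t ?l))) < K"
    unfolding level_def
    using Least_le[of "\<lambda>j. length (active_part t (?l j)) < K" j0] LeastI[of "\<lambda>j. length (active_part t (?l j)) < K" j0]
    by auto
  have levJ: "level t ?l \<le> J" using lev(1) j0(1) by linarith
  have "length (filter (\<lambda>it. range_fun R (pt it) \<noteq> label it) (active_part t (?l (level t ?l)))) =
      card (error_set ys t R \<inter> samp B (level t ?l) ?A)"
    using lev(2) levJ stored_active(2)[of t K ys "samp B (level t ?l) {..<length ys}" "\<lambda>it. range_fun R (pt it) \<noteq> label it"]
    by (simp add: copy_state_def active_part_def set2)
  then have "real (estimate t ?l R) = 2 ^ level t ?l * real (card (error_set ys t R \<inter> samp B (level t ?l) ?A))"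
    by (simp add: estimate_def)
  then show ?thesis using j0(3)[of "error_set ys t R" "level t ?l"] R lev(1) by simp
qed

end

section \<open>Correctness and space\<close>

lemma range_fun_cases: "range_fun R x \<in> {-1, 1}"
  by (simp add: range_fun_def)

text \<open>A point that separates two ranges is a shattered singleton. Applied in both directions,
  this leaves a single range.\<close>

lemma VC_dim_0_unique:
  assumes "range_space X \<R>" "VC_dim X \<R> = 0" and R: "R \<in> \<R>" "R' \<in> \<R>"
  shows "R \<subseteq> R'"
proof
  fix x assume x: "x \<in> R"
  show "x \<in> R'"
  proof (rule ccontr)
    assume x': "x \<notin> R'"
    have "shatters \<R> {x}"
      unfolding shatters_def
    proof (intro allI impI)
      fix B assume "B \<subseteq> {x}"
      then consider "B = {}" | "B = {x}" by blast
      then show "\<exists>R\<in>\<R>. {x} \<inter> R = B" using x x' R by cases auto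
    qed
    moreover have "x \<in> X" using assms(1) x R by (auto simp: range_space_def)
    ultimately have "enat (card {x}) \<le> VC_dim X \<R>"
      unfolding VC_dim_def by (intro Sup_upper) (auto intro!: exI[of _ "{x}"])
    then show False using assms(2) by (simp add: enat_0_iff)
  qed
qed

context level_sketch
begin

text \<open>On a shattered set of positions the points are distinct: two equal points with equal
  labels cannot be separated by any range, and with opposite labels they cannot both be errors of
  \<open>R0\<close>. Labels then only flip membership, so the points are shattered by the
  ranges.\<close>

lemma shatters_error_sets:
  assumes ys: "\<And>it. it \<in> set ys \<Longrightarrow> proper_item it" and VC: "VC_dim (space_dim d) \<R> = enat \<nu>"
    and T: "finite T" "shatters (error_set ys t ` \<R>) T"
  shows "card T \<le> \<nu>"
proof -
  define x where "x = (\<lambda>i. pt (ys ! i))"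
  define y where "y = (\<lambda>i. label (ys ! i))"
  have sh: "\<exists>R\<in>\<R>. T \<inter> error_set ys t R = B" if "B \<subseteq> T" for B
    using T(2) that unfolding shatters_def by blast
  obtain R0 where R0: "R0 \<in> \<R>" "T \<inter> error_set ys t R0 = T" using sh[of T] by blast
  then have act: "i \<in> active ys t" if "i \<in> T" for i using that by (auto simp: error_set_def)
  then have item: "proper_item (ys ! i)" if "i \<in> T" for i
    using that ys by (auto simp: active_def)
  have lab: "y i \<in> {-1, 1}" if "i \<in> T" for i using item[OF that] by (simp add: proper_item_def y_def)
  have mem: "i \<in> error_set ys t R \<longleftrightarrow> range_fun R (x i) \<noteq> y i" if "i \<in> T" for i R
    using act[OF that] by (simp add: error_set_def x_def y_def)
  have inj: "inj_on x T"
  proof (rule inj_onI, rule ccontr)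
    fix i j assume ij: "i \<in> T" "j \<in> T" "x i = x j" "i \<noteq> j"
    show False
    proof (cases "y i = y j")
      case True
      obtain R where "R \<in> \<R>" "T \<inter> error_set ys t R = {i}" using sh[of "{i}"] ij by blast
      then show False using mem[of i R] mem[of j R] ij True by auto
    next
      case False
      then show False using mem[of i R0] mem[of j R0] R0 ij lab[of i] lab[of j] range_fun_cases[of R0 "x i"] by auto
    qed
  qed
  have "shatters \<R> (x ` T)"
    unfolding shatters_def
  proof (intro allI impI)
    fix Q assume Q: "Q \<subseteq> x ` T"
    \<comment> \<open>The requested pattern is the set of errors that \<open>Q\<close> itself would
      make; agreeing on errors means agreeing on points.\<close>
    obtain R where R: "R \<in> \<R>" "T \<inter> error_set ys t R = {i \<in> T. range_fun Q (x i) \<noteq> y i}"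
      using sh[of "{i \<in> T. range_fun Q (x i) \<noteq> y i}"] by blast
    have "x i \<in> R \<longleftrightarrow> x i \<in> Q" if i: "i \<in> T" for i
    proof -
      have "range_fun R (x i) \<noteq> y i \<longleftrightarrow> range_fun Q (x i) \<noteq> y i" using R(2) mem[OF i, of R] i by blast
      then show ?thesis using lab[OF i] by (auto simp: range_fun_def split: if_splits)
    qed
    then have "x ` T \<inter> R = Q" using Q by auto
    then show "\<exists>R\<in>\<R>. x ` T \<inter> R = Q" using R by blast
  qed
  moreover have "x ` T \<subseteq> space_dim d" using item by (auto simp: x_def proper_item_def space_dim_def)
  ultimately have "enat (card (x ` T)) \<le> VC_dim (space_dim d) \<R>"
    unfolding VC_dim_def using T(1) by (intro Sup_upper) (auto intro!: exI[of _ "x ` T"])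
  then show ?thesis by (simp add: VC card_image[OF inj])
qed

lemma finite_active: "finite (active ys t)"
  by (simp add: active_def)

lemma err_range_fun:
  assumes "active ys t \<noteq> {}"
  shows "err ys t (range_fun R) = real (card (error_set ys t R)) / real (card (active ys t))"
proof -
  have "active ys t \<inter> {i. range_fun R (pt (ys ! i)) \<noteq> label (ys ! i)} = error_set ys t R"
    by (auto simp: error_set_def)
  then show ?thesis using assms finite_active by (simp add: err_def measure_pmf_of_set)
qed

lemma answer_close:
  fixes \<epsilon> :: real
  assumes ne: "active ys t \<noteq> {}" and \<R>: "\<R> \<noteq> {}"
    and close: "\<And>R. R \<in> \<R> \<Longrightarrow> \<bar>real (card (error_set ys t R)) - real (med L (\<lambda>c. estimate t (st c) R))\<bar>
      \<le> \<epsilon> * real (card (active ys t)) / 2"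
  shows "\<bar>err ys t (answer st t) - err ys t (best_fun \<R> ys t)\<bar> \<le> \<epsilon>"
proof -
  define N where "N = real (card (active ys t))"
  have N: "N > 0" using ne finite_active by (simp add: N_def card_gt_0_iff)
  define g where "g = (\<lambda>R. med L (\<lambda>c. estimate t (st c) R))"
  define R1 where "R1 = (ARG_MIN g R. R \<in> \<R>)"
  define R2 where "R2 = (ARG_MIN (\<lambda>R. err ys t (range_fun R)) R. R \<in> \<R>)"
  obtain R where R: "R \<in> \<R>" using \<R> by blast
  have R1: "R1 \<in> \<R>" "\<And>R. R \<in> \<R> \<Longrightarrow> g R1 \<le> g R"
    unfolding R1_def using arg_min_natI[of "\<lambda>R. R \<in> \<R>" R g] arg_min_nat_le[of "\<lambda>R. R \<in> \<R>" _ g] R by blast+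
  \<comment> \<open>\<open>ARG_MIN\<close> of a real function has its defining property only if a
    minimizer exists. All errors share the denominator \<open>N\<close>, so a range minimizing the
    natural number of errors supplies one.\<close>
  define R3 where "R3 = (ARG_MIN (\<lambda>R. card (error_set ys t R)) R. R \<in> \<R>)"
  have "R3 \<in> \<R>" "\<And>R. R \<in> \<R> \<Longrightarrow> card (error_set ys t R3) \<le> card (error_set ys t R)"
    unfolding R3_def
    using arg_min_natI[of "\<lambda>R. R \<in> \<R>" R "\<lambda>R. card (error_set ys t R)"]
      arg_min_nat_le[of "\<lambda>R. R \<in> \<R>" _ "\<lambda>R. card (error_set ys t R)"] R by blast+
  then have "is_arg_min (\<lambda>R. err ys t (range_fun R)) (\<lambda>R. R \<in> \<R>) R3"
    using N by (auto simp: is_arg_min_linorder err_range_fun[OF ne] N_def[symmetric] divide_right_mono)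
  then have "is_arg_min (\<lambda>R. err ys t (range_fun R)) (\<lambda>R. R \<in> \<R>) R2"
    unfolding R2_def arg_min_def by (rule someI)
  then have R2: "R2 \<in> \<R>" "\<And>R. R \<in> \<R> \<Longrightarrow> err ys t (range_fun R2) \<le> err ys t (range_fun R)"
    by (auto simp: is_arg_min_linorder)
  have "real (card (error_set ys t R1)) \<le> real (g R1) + \<epsilon> * N / 2"
    using close[OF R1(1)] unfolding g_def N_def by linarith
  moreover have "real (g R1) \<le> real (g R2)" using R1(2)[OF R2(1)] by simp
  moreover have "real (g R2) \<le> real (card (error_set ys t R2)) + \<epsilon> * N / 2"
    using close[OF R2(1)] unfolding g_def N_def by linarith
  ultimately have "real (card (error_set ys t R1)) \<le> real (card (error_set ys t R2)) + \<epsilon> * N" by linarith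
  then have "real (card (error_set ys t R1)) / N \<le> (real (card (error_set ys t R2)) + \<epsilon> * N) / N"
    using N by (intro divide_right_mono) auto
  then have "err ys t (range_fun R1) \<le> err ys t (range_fun R2) + \<epsilon>"
    using N by (simp add: err_range_fun[OF ne] N_def add_divide_distrib)
  moreover have "err ys t (range_fun R2) \<le> err ys t (range_fun R1)" by (rule R2(2)[OF R1(1)])
  ultimately have "\<bar>err ys t (range_fun R1) - err ys t (range_fun R2)\<bar> \<le> \<epsilon>" by linarith
  then show ?thesis by (simp add: answer_def best_fun_def R1_def R2_def g_def)
qed

lemma prob_answer_close:
  fixes \<epsilon> :: real
  assumes ys: "\<And>it. it \<in> set ys \<Longrightarrow> proper_item it" and t: "\<And>it. it \<in> set ys \<Longrightarrow> ins_time it \<le> t"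
    and ne: "active ys t \<noteq> {}" and \<R>: "\<R> \<noteq> {}" and VC: "VC_dim (space_dim d) \<R> = enat \<nu>" and \<nu>: "\<nu> \<ge> 1"
    and \<epsilon>: "0 < \<epsilon>" "\<epsilon> < 1" and K: "real K \<ge> 73728\<^sup>2 * (real \<nu> / \<epsilon>\<^sup>2)" and J: "length ys \<le> 2 ^ J"
  shows "measure_pmf.prob (run the_sketch ys)
    {s. \<bar>err ys t (query the_sketch s t) - err ys t (best_fun \<R> ys t)\<bar> \<le> \<epsilon>} \<ge> 1 - (1/2) ^ L"
proof -
  let ?S = "{s. \<bar>err ys t (query the_sketch s t) - err ys t (best_fun \<R> ys t)\<bar> \<le> \<epsilon>}"
  let ?G = "good_coins (real K) \<epsilon> J (active ys t) (error_set ys t ` \<R>)"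
  have actU: "active ys t \<subseteq> {..<length ys}" by (auto simp: active_def)
  have "measure_pmf.prob (coins J {..<length ys}) ?G \<ge> 15/16"
  proof (rule prob_good_coins[OF _ actU ne _ _ \<nu> \<epsilon> K])
    show "error_set ys t ` \<R> \<subseteq> Pow (active ys t)" by (auto simp: error_set_def)
    show "card T \<le> \<nu>" if "finite T" "shatters (error_set ys t ` \<R>) T" for T
      using shatters_error_sets[OF ys VC that] by simp
    show "card (active ys t) \<le> 2 ^ J" using card_mono[OF _ actU] J by simp
  qed simp
  then have maj: "measure_pmf.prob (all_coins (length ys)) {Bs. 2 * card {c. c < L \<and> Bs c \<notin> ?G} < L} \<ge> 1 - (1/2) ^ L"
    unfolding all_coins_def by (rule prob_majority) (simp add: finite_set_coins)
  have sub: "{Bs. 2 * card {c. c < L \<and> Bs c \<notin> ?G} < L} \<subseteq> (\<lambda>Bs. encode (all_state ys Bs)) -` ?S"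
  proof
    fix Bs assume Bs: "Bs \<in> {Bs. 2 * card {c. c < L \<and> Bs c \<notin> ?G} < L}"
    let ?st = "all_state ys Bs"
    have "\<bar>err ys t (answer ?st t) - err ys t (best_fun \<R> ys t)\<bar> \<le> \<epsilon>"
    proof (rule answer_close[OF ne \<R>])
      fix R assume R: "R \<in> \<R>"
      let ?e = "\<lambda>c. estimate t (?st c) R"
      let ?a = "real (card (error_set ys t R))" and ?b = "\<epsilon> * real (card (active ys t)) / 2"
      have "{c. c < L \<and> \<not> (?a - ?b \<le> real (?e c) \<and> real (?e c) \<le> ?a + ?b)} \<subseteq> {c. c < L \<and> Bs c \<notin> ?G}"
      proof (intro subsetI CollectI conjI notI)
        fix c assume "c \<in> {c. c < L \<and> \<not> (?a - ?b \<le> real (?e c) \<and> real (?e c) \<le> ?a + ?b)}"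
        then have c1: "c < L" and no: "\<not> (?a - ?b \<le> real (?e c) \<and> real (?e c) \<le> ?a + ?b)" by auto
        show "c < L" by fact
        assume c2: "Bs c \<in> ?G"
        have "\<bar>?a - real (?e c)\<bar> \<le> ?b" using estimate_close[OF t R c2] c1 by (simp add: all_state_def)
        with no show False by linarith
      qed
      then have "card {c. c < L \<and> \<not> (?a - ?b \<le> real (?e c) \<and> real (?e c) \<le> ?a + ?b)} \<le> card {c. c < L \<and> Bs c \<notin> ?G}"
        by (intro card_mono) auto
      then have "2 * card {c. c < L \<and> \<not> (?a - ?b \<le> real (?e c) \<and> real (?e c) \<le> ?a + ?b)} < L" using Bs by simp
      from med_bounds[OF this] show "\<bar>?a - real (med L ?e)\<bar> \<le> ?b" by linarith
    qed
    moreover have "query the_sketch (encode ?st) t = answer ?st t"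
      using decode_encode[OF proper_all_state[OF ys]] by (simp add: the_sketch_def)
    ultimately show "Bs \<in> (\<lambda>Bs. encode (all_state ys Bs)) -` ?S" by simp
  qed
  have "measure_pmf.prob (run the_sketch ys) ?S =
      measure_pmf.prob (all_coins (length ys)) ((\<lambda>Bs. encode (all_state ys Bs)) -` ?S)"
    using run_the_sketch[OF ys] by simp
  also have "\<dots> \<ge> measure_pmf.prob (all_coins (length ys)) {Bs. 2 * card {c. c < L \<and> Bs c \<notin> ?G} < L}"
    by (rule measure_pmf.finite_measure_mono[OF sub]) simp
  finally show ?thesis using maj by linarith
qed

lemma run_the_sketch_memory:
  assumes ys: "\<And>it. it \<in> set ys \<Longrightarrow> proper_item it" and s: "s \<in> set_pmf (run the_sketch ys)"
  shows "set s \<subseteq> words 0 n ys" "length s = L * (Suc J * K) * (d + 3)"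
proof -
  obtain Bs where Bs: "s = encode (all_state ys Bs)" using s run_the_sketch[OF ys] by auto
  have p: "proper (all_state ys Bs)" by (rule proper_all_state[OF ys])
  show "length s = L * (Suc J * K) * (d + 3)" unfolding Bs by (rule length_encode[OF p])
  \<comment> \<open>As \<open>n ^ 0 = 1\<close> for every \<open>n\<close>, exponent 0 admits
    exactly these integers.\<close>
  have "{-1, 0, 1} \<subseteq> {of_int z :: real | z. \<bar>z\<bar> \<le> int (n ^ 0)}"
    by (auto intro: exI[of _ "-1"] exI[of _ 0] exI[of _ 1])
  with set_encode[OF p set_all_state] show "set s \<subseteq> words 0 n ys"
    unfolding Bs words_def by blast
qed

end

section \<open>Choice of parameters\<close>

lemma ceiling_log2:
  fixes x :: real
  assumes "x > 0"
  shows "x \<le> 2 ^ nat \<lceil>log 2 x\<rceil>"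
proof -
  have "x = 2 powr log 2 x" using assms by simp
  also have "\<dots> \<le> 2 powr real (nat \<lceil>log 2 x\<rceil>)" by (intro powr_mono) linarith+
  finally show ?thesis by (simp add: powr_realpow)
qed

text \<open>Since \<open>lg\<close> is at least 1, rounding up at most doubles it.\<close>

lemma nat_ceiling_log2_le: "real (nat \<lceil>log 2 x\<rceil>) \<le> 2 * lg x"
  unfolding lg_def by linarith

theorem theorem6p5:
  shows "\<exists>(C::real) > 0. \<exists>c::nat. \<forall>(d::nat) (\<R>::point set set) (\<nu>::nat) (\<epsilon>::real) (\<delta>::real) (n::nat).
    d \<ge> 1 \<longrightarrow> range_space (space_dim d) \<R> \<longrightarrow> VC_dim (space_dim d) \<R> = enat \<nu> \<longrightarrow>
    0 < \<epsilon> \<longrightarrow> \<epsilon> < 1 \<longrightarrow> 0 < \<delta> \<longrightarrow> \<delta> < 1 \<longrightarrow>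
    (\<exists>sk. PAC_sketch d \<R> n \<epsilon> \<delta> sk \<and>
          uses_space c d n sk (C * ((real \<nu> / \<epsilon>\<^sup>2) * real d * lg (real n) * lg (1 / \<delta>))))"
proof (rule exI[of _ "48 * 73728\<^sup>2"], intro conjI exI[of _ 0] allI impI)
  fix d n \<nu> :: nat and \<R> :: "point set set" and \<epsilon> \<delta> :: real
  assume d: "1 \<le> d" and \<R>: "range_space (space_dim d) \<R>" and VC: "VC_dim (space_dim d) \<R> = enat \<nu>"
    and \<epsilon>: "0 < \<epsilon>" "\<epsilon> < 1" and \<delta>: "0 < \<delta>" "\<delta> < 1"
  let ?bound = "48 * 73728\<^sup>2 * (real \<nu> / \<epsilon>\<^sup>2 * real d * lg (real n) * lg (1 / \<delta>))"
  have ne: "\<R> \<noteq> {}" using \<R> by (simp add: range_space_def)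
  show "\<exists>sk. PAC_sketch d \<R> n \<epsilon> \<delta> sk \<and> uses_space 0 d n sk ?bound"
  proof (cases "\<nu> = 0")
    \<comment> \<open>The space bound is 0 here, so the memory stays empty and the only range is
      built into the query.\<close>
    case True
    obtain R where "R \<in> \<R>" using ne by blast
    moreover have "VC_dim (space_dim d) \<R> = 0" using VC True by (simp add: zero_enat_def)
    ultimately have \<R>_eq: "\<R> = {R}" using VC_dim_0_unique[OF \<R>] by blast
    have best: "best_fun \<R> ys t = range_fun R" for ys t
    proof -
      define f where "f = (\<lambda>R. err ys t (range_fun R))"
      have "is_arg_min f (\<lambda>R'. R' \<in> {R}) (ARG_MIN f R'. R' \<in> {R})"
        unfolding arg_min_def by (rule someI[of _ R]) (simp add: is_arg_min_def)
      then show ?thesis by (simp add: best_fun_def \<R>_eq is_arg_min_def f_def)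
    qed
    define sk where "sk = Sketch (return_pmf []) (\<lambda>_ _. return_pmf []) (\<lambda>_ _. range_fun R)"
    have run: "run sk ys = return_pmf []" for ys
      by (induction ys rule: rev_induct) (simp_all add: run_def sk_def bind_return_pmf)
    have "PAC_sketch d \<R> n \<epsilon> \<delta> sk"
      using \<epsilon> \<delta> range_fun_cases[of R] by (simp add: PAC_sketch_def run best) (simp add: sk_def)
    moreover have "uses_space 0 d n sk ?bound" using True by (simp add: uses_space_def run)
    ultimately show ?thesis by blast
  next
    case False
    then have \<nu>: "\<nu> \<ge> 1" by simp
    define r where "r = 73728\<^sup>2 * (real \<nu> / \<epsilon>\<^sup>2)"
    define K where "K = nat \<lceil>r\<rceil>"
    define J where "J = nat \<lceil>log 2 (real n)\<rceil>"
    define L where "L = nat \<lceil>log 2 (1 / \<delta>)\<rceil>"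
    interpret level_sketch d K J L \<R> .
    have "1 \<le> real \<nu> / \<epsilon>\<^sup>2"
      using \<nu> \<epsilon> power_mono[of \<epsilon> 1 2] by (simp add: pos_le_divide_eq)
    then have r1: "r \<ge> 1" by (simp add: r_def)
    have K: "real K \<ge> r" "real K \<le> 2 * r" unfolding K_def using r1 by linarith+
    have nJ: "n \<le> 2 ^ J"
    proof (cases "n = 0")
      case False
      then have "real n \<le> 2 ^ J" unfolding J_def by (intro ceiling_log2) simp
      then show ?thesis by (metis of_nat_le_iff of_nat_numeral of_nat_power)
    qed simp
    have L: "(1/2) ^ L \<le> \<delta>"
    proof -
      have "1 / \<delta> \<le> 2 ^ L" unfolding L_def using \<delta> by (intro ceiling_log2) simp
      then show ?thesis using \<delta> by (simp add: power_divide divide_le_eq mult.commute)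
    qed
    have pitem: "proper_item it" if "expiration_stream d xs" "it \<in> set (take m xs)" for xs m it
      using that by (auto simp: expiration_stream_def proper_item_def space_dim_def dest: in_set_takeD)
    have "PAC_sketch d \<R> n \<epsilon> \<delta> the_sketch"
      unfolding PAC_sketch_def
    proof (intro conjI allI impI)
      show "query the_sketch s t x \<in> {- 1, 1}" for s t x
        by (simp add: the_sketch_def answer_def range_fun_cases del: insert_iff)
      fix xs m t assume xs: "expiration_stream d xs" "length xs = n" and "m \<le> n"
        and t: "\<forall>it\<in>set (take m xs). ins_time it \<le> t" and act: "active (take m xs) t \<noteq> {}"
      have "1 - (1/2) ^ L \<le> measure_pmf.prob (run the_sketch (take m xs))
        {s. \<bar>err (take m xs) t (query the_sketch s t) - err (take m xs) t (best_fun \<R> (take m xs) t)\<bar> \<le> \<epsilon>}"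
      proof (rule prob_answer_close[OF pitem[OF xs(1)] _ act ne VC \<nu> \<epsilon>])
        show "length (take m xs) \<le> 2 ^ J" using nJ xs by simp
      qed (use t K(1) in \<open>auto simp: r_def\<close>)
      with L show "1 - \<delta> \<le> measure_pmf.prob (run the_sketch (take m xs))
        {s. \<bar>err (take m xs) t (query the_sketch s t) - err (take m xs) t (best_fun \<R> (take m xs) t)\<bar> \<le> \<epsilon>}"
        by linarith
    qed
    moreover have "uses_space 0 d n the_sketch ?bound"
      unfolding uses_space_def
    proof (intro allI impI ballI conjI)
      fix xs m s assume xs: "expiration_stream d xs" "length xs = n" "m \<le> n"
        and s: "s \<in> set_pmf (run the_sketch (take m xs))"
      note mem = run_the_sketch_memory[OF pitem[OF xs(1)] s]
      show "set s \<subseteq> words 0 n (take m xs)" by (rule mem(1))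
      have "real (length s) = real L * (real (Suc J) * real K) * real (d + 3)" by (simp only: mem(2) of_nat_mult)
      \<comment> \<open>The factors are 2 for \<open>L\<close>, 3 for the \<open>J + 1\<close>
        levels, 2 for rounding \<open>K\<close>, and 4 from \<open>d + 3 <= 4 * d\<close>; their
        product is 48.\<close>
      also have "\<dots> \<le> (2 * lg (1 / \<delta>)) * ((3 * lg (real n)) * (2 * r)) * (4 * real d)"
      proof (intro mult_mono)
        show "real L \<le> 2 * lg (1 / \<delta>)" unfolding L_def by (rule nat_ceiling_log2_le)
        have "lg (real n) \<ge> 1" by (simp add: lg_def)
        then show "real (Suc J) \<le> 3 * lg (real n)" using nat_ceiling_log2_le[of "real n"] by (simp add: J_def)
      qed (use K r1 d in \<open>auto simp: lg_def max_def\<close>)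
      also have "\<dots> = ?bound" by (simp add: r_def)
      finally show "real (length s) \<le> ?bound" .
    qed
    ultimately show ?thesis by blast
  qed
qed simp

end
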